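(* Let $\Theta$ be a minimal L-system with input-output space $\mathbb C$ and $J=1$, whose main operator $T$ has von Neumann parameter $\kappa$ with $0<\kappa<1$, and whose impedance function $V_\Theta(z)$ is not identically constant in $\mathbb C_+$. Then $V_\Theta$ belongs to the generalized Donoghue class $\mathfrak M_\kappa^{-1}$ if and only if the quasi-kernel $\hat A$ of $\mathrm{Re}\,\mathbb A$ (together with $T$) satisfies Hypothesis II, i.e. there exist normalized $g_\pm\in\ker(\dot A^*\mp iI)$ with $g_++g_-\in\mathrm{Dom}(\hat A)$ and $g_+-\kappa g_-\in\mathrm{Dom}(T)$.
   Context: Let $\dot A$ be a closed, densely defined symmetric operator with deficiency indices $(1,1)$ in a Hilbert space $\mathcal H$. Let $\mathcal H_+=\mathrm{Dom}(\dot A^* )$ with inner product $(f,g)_+=(f,g)+(\dot A^*f,\dot A^*g)$, and let $\mathcal H_+\subset\mathcal H\subset\mathcal H_-$ be the associated rigged Hilbert space ($\mathcal H_-$ is the dual of $\mathcal H_+$ with respect to the pairing extending the inner product of $\mathcal H$). For a bounded $\mathbb A:\mathcal H_+\to\mathcal H_-$ the adjoint $\mathbb A^*$ is again bounded $\mathcal H_+\to\mathcal H_-$; $\mathrm{Re}\,\mathbb A=(\mathbb A+\mathbb A^* )/2$, $\mathrm{Im}\,\mathbb A=(\mathbb A-\mathbb A^* )/(2i)$. An operator $T$ with $\dot A\subset T\subset\dot A^*$ belongs to the class $\Lambda(\dot A)$ if $\rho(T)\neq\emptyset$ and $\mathrm{Dom}(\dot A)=\mathrm{Dom}(T)\cap\mathrm{Dom}(T^*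 )$. A bounded $\mathbb A:\mathcal H_+\to\mathcal H_-$ is a $( * )$-extension of $T$ if $\mathbb A\supset T\supset\dot A$, $\mathbb A^*\supset T^*\supset\dot A$, and the quasi-kernel $\hat A$ of $\mathrm{Re}\,\mathbb A$, i.e. the restriction of $\mathrm{Re}\,\mathbb A$ to $\{f\in\mathcal H_+:\mathrm{Re}\,\mathbb A f\in\mathcal H\}$, is a self-adjoint operator in $\mathcal H$. An L-system (with input-output space $\mathbb C$ and $J=1$) is an array $\Theta=\begin{pmatrix}\mathbb A&K&1\\ \mathcal H_+\subset\mathcal H\subset\mathcal H_-&&\mathbb C\end{pmatrix}$, where $\mathbb A$ is a $( * )$-extension of some $T\in\Lambda(\dot A)$ and $K:\mathbb C\to\mathcal H_-$ is bounded with adjoint $K^*:\mathcal H_+\to\mathbb C$, $\mathrm{Im}\,\mathbb A=KK^*$, $\mathrm{Ran}(K)=\mathrm{Ran}(\mathrm{Im}\,\mathbb A)$. $T$ is the main operator. $\Theta$ is minimal if $\dot A$ is prime (there is no nontrivial reducing subspace on which $\dot A$ induces a self-adjoint operator). The impedance function is $V_\Theta(z)=K^*(\mathrm{Re}\,\mathbb A-zI)^{-1}K$, $z\in\rho(\hat A)$ (well defined). Von Neumann parameter: the main operator $T$ is a maximal dissipative extension of $\dot A$, and there are normalized deficiency vectors $g_\pm\in\ker(\dot A^*\mp iI)$, $\|g_\pm\|=1$, with $g_+-\kappa g_-\in\mathrm{Dom}(T)$ and $0\le\kappa<1$; the number $\kappa$ is the von Neumann parameter of $T$. Class $\mathfrak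 M_\kappa^{-1}$ ($0\le\kappa<1$): all analytic $M:\mathbb C_+\to\mathbb C_+$ of the form $M(z)=\int_{\mathbb R}\left(\frac1{\lambda-z}-\frac{\lambda}{1+\lambda^2}\right)d\mu(\lambda)$, with $\mu$ an infinite Borel measure with $\int_{\mathbb R}\frac{d\mu(\lambda)}{1+\lambda^2}=\frac{1+\kappa}{1-\kappa}$ (equivalently $M(i)=i\frac{1+\kappa}{1-\kappa}$). *)

theory Defs
  imports "HOL-Complex_Analysis.Complex_Analysis"
begin

section \<open>Complex Hilbert spaces\<close>

text \<open>The inner product is linear in the first and antilinear in the second argument.\<close>

class complex_hilbert = banach +
  fixes scaleC :: "complex \<Rightarrow> 'a \<Rightarrow> 'a" (infixr "*\<^sub>C" 75)
    and cinner :: "'a \<Rightarrow> 'a \<Rightarrow> complex"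
  assumes scaleR_scaleC: "scaleR r x = scaleC (complex_of_real r) x"
    and scaleC_add_right: "scaleC a (x + y) = scaleC a x + scaleC a y"
    and scaleC_add_left: "scaleC (a + b) x = scaleC a x + scaleC b x"
    and scaleC_scaleC: "scaleC a (scaleC b x) = scaleC (a * b) x"
    and scaleC_one: "scaleC 1 x = x"
    and cinner_add_left: "cinner (x + y) z = cinner x z + cinner y z"
    and cinner_scaleC_left: "cinner (scaleC a x) y = a * cinner x y"
    and cinner_commute: "cinner x y = cnj (cinner y x)"
    and cinner_self: "cinner x x = complex_of_real ((norm x)\<^sup>2)"

global_interpretation complex_vector: vector_space "scaleC :: complex \<Rightarrow> 'a \<Rightarrow> 'a::complex_hilbert"
  by unfold_locales
    (simp_all add: scaleC_add_right scaleC_add_left scaleC_scaleC scaleC_one)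

instantiation complex :: complex_hilbert
begin

definition scaleC_complex :: "complex \<Rightarrow> complex \<Rightarrow> complex" where
  "scaleC_complex a x = a * x"

definition cinner_complex :: "complex \<Rightarrow> complex \<Rightarrow> complex" where
  "cinner_complex x y = x * cnj y"

instance
proof
  fix x :: complex
  show "cinner x x = complex_of_real ((norm x)\<^sup>2)"
    by (simp only: cinner_complex_def complex_norm_square)
qed (simp_all add: scaleC_complex_def cinner_complex_def algebra_simps scaleR_conv_of_real)

end


section \<open>Unbounded operators, represented by their graphs\<close>

type_synonym 'h graph = "('h \<times> 'h) set"

definition linear_op :: "'h::complex_hilbert graph \<Rightarrow> bool" where
  "linear_op S \<longleftrightarrow> single_valued S \<and> (0, 0) \<in> S
     \<and> (\<forall>f f' g g'. (f, f') \<in> S \<and> (g, g') \<in> S \<longrightarrow> (f + g, f' + g') \<in> S)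
     \<and> (\<forall>c f f'. (f, f') \<in> S \<longrightarrow> (c *\<^sub>C f, c *\<^sub>C f') \<in> S)"

definition app :: "'h graph \<Rightarrow> 'h \<Rightarrow> 'h" where
  "app S f = (THE g. (f, g) \<in> S)"

definition symmetric_op :: "'h::complex_hilbert graph \<Rightarrow> bool" where
  "symmetric_op S \<longleftrightarrow>
     (\<forall>f f' g g'. (f, f') \<in> S \<and> (g, g') \<in> S \<longrightarrow> cinner f' g = cinner f g')"

text \<open>Adjoint of an operator acting in the closed subspace \<open>M\<close>; it is the graph of an operator
  when the domain of \<open>S\<close> is dense in \<open>M\<close>.\<close>

definition adjoint_on :: "'h::complex_hilbert set \<Rightarrow> 'h graph \<Rightarrow> 'h graph" where
  "adjoint_on M S =
     {(g, h). g \<in> M \<and> h \<in> M \<and> (\<forall>f f'. (f, f') \<in> S \<longrightarrow> cinner f' g = cinner f h)}"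

abbreviation adjoint :: "'h::complex_hilbert graph \<Rightarrow> 'h graph" where
  "adjoint S \<equiv> adjoint_on UNIV S"

definition selfadjoint_on :: "'h::complex_hilbert set \<Rightarrow> 'h graph \<Rightarrow> bool" where
  "selfadjoint_on M S \<longleftrightarrow> linear_op S \<and> M \<subseteq> closure (Domain S) \<and> adjoint_on M S = S"

abbreviation selfadjoint :: "'h::complex_hilbert graph \<Rightarrow> bool" where
  "selfadjoint S \<equiv> selfadjoint_on UNIV S"

definition closed_densely_defined_symmetric :: "'h::complex_hilbert graph \<Rightarrow> bool" where
  "closed_densely_defined_symmetric S \<longleftrightarrow>
     linear_op S \<and> closed S \<and> closure (Domain S) = UNIV \<and> symmetric_op S"

text \<open>\<open>deficiency_space A z\<close> is the kernel of \<open>A\<^sup>* - zI\<close>.\<close>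

definition deficiency_space :: "'h::complex_hilbert graph \<Rightarrow> complex \<Rightarrow> 'h set" where
  "deficiency_space A z = {g. (g, z *\<^sub>C g) \<in> adjoint A}"

text \<open>The library's \<open>dim\<close> is \<open>0\<close> on infinite-dimensional subspaces, so a value \<open>1\<close>
  really means dimension one.\<close>

definition deficiency_indices_1_1 :: "'h::complex_hilbert graph \<Rightarrow> bool" where
  "deficiency_indices_1_1 A \<longleftrightarrow>
     complex_vector.dim (deficiency_space A \<i>) = 1 \<and>
     complex_vector.dim (deficiency_space A (- \<i>)) = 1"

definition resolvent_set :: "'h::complex_hilbert graph \<Rightarrow> complex set" where
  "resolvent_set S = {z.
     (\<forall>h. \<exists>!f. \<exists>g. (f, g) \<in> S \<and> g - z *\<^sub>C f = h) \<and>
     (\<exists>C. \<forall>(f, g) \<in> S. norm f \<le> C * norm (g - z *\<^sub>C f))}"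

definition orth :: "'h::complex_hilbert set \<Rightarrow> 'h set" where
  "orth M = {x. \<forall>m\<in>M. cinner x m = 0}"

text \<open>\<open>M\<close> reduces \<open>A\<close>: the orthogonal projection \<open>P\<close> onto \<open>M\<close> maps the domain of \<open>A\<close> into itself
  and \<open>A P f = P A f\<close> there. Below, \<open>m = P f\<close> and \<open>m' = P f'\<close>.\<close>

definition reducing_subspace :: "'h::complex_hilbert graph \<Rightarrow> 'h set \<Rightarrow> bool" where
  "reducing_subspace A M \<longleftrightarrow> complex_vector.subspace M \<and> closed M \<and>
     (\<forall>(f, f') \<in> A. \<exists>m m'. m \<in> M \<and> f - m \<in> orth M \<and> m' \<in> M \<and> f' - m' \<in> orth M
        \<and> (m, m') \<in> A)"

definition prime_op :: "'h::complex_hilbert graph \<Rightarrow> bool" where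
  "prime_op A \<longleftrightarrow>
     \<not> (\<exists>M. M \<noteq> {0} \<and> reducing_subspace A M \<and> selfadjoint_on M (A \<inter> M \<times> M))"

definition dissipative :: "'h::complex_hilbert graph \<Rightarrow> bool" where
  "dissipative S \<longleftrightarrow> (\<forall>(f, g) \<in> S. Im (cinner g f) \<ge> 0)"

definition maximal_dissipative :: "'h::complex_hilbert graph \<Rightarrow> bool" where
  "maximal_dissipative S \<longleftrightarrow> linear_op S \<and> dissipative S \<and>
     (\<forall>S'. linear_op S' \<and> dissipative S' \<and> S \<subseteq> S' \<longrightarrow> S' = S)"


section \<open>The rigged Hilbert space of a symmetric operator\<close>

definition H_plus :: "'h::complex_hilbert graph \<Rightarrow> 'h set" where
  "H_plus A = Domain (adjoint A)"

definition inner_plus :: "'h::complex_hilbert graph \<Rightarrow> 'h \<Rightarrow> 'h \<Rightarrow> complex" where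
  "inner_plus A f g = cinner f g + cinner (app (adjoint A) f) (app (adjoint A) g)"

definition norm_plus :: "'h::complex_hilbert graph \<Rightarrow> 'h \<Rightarrow> real" where
  "norm_plus A f = sqrt (Re (inner_plus A f f))"

text \<open>An element of \<open>H_-\<close> is the bounded antilinear functional \<open>g \<mapsto> (\<phi>, g)\<close> on \<open>H_+\<close>,
  extended by \<open>0\<close> outside \<open>H_+\<close> so that equality of functionals is equality of functions.\<close>

definition H_minus :: "'h::complex_hilbert graph \<Rightarrow> ('h \<Rightarrow> complex) set" where
  "H_minus A = {\<phi>.
     (\<forall>f\<in>H_plus A. \<forall>g\<in>H_plus A. \<phi> (f + g) = \<phi> f + \<phi> g) \<and>
     (\<forall>c. \<forall>f\<in>H_plus A. \<phi> (c *\<^sub>C f) = cnj c * \<phi> f) \<and>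
     (\<exists>C. \<forall>f\<in>H_plus A. cmod (\<phi> f) \<le> C * norm_plus A f) \<and>
     (\<forall>f. f \<notin> H_plus A \<longrightarrow> \<phi> f = 0)}"

definition norm_minus :: "'h::complex_hilbert graph \<Rightarrow> ('h \<Rightarrow> complex) \<Rightarrow> real" where
  "norm_minus A \<phi> = (SUP f\<in>{f \<in> H_plus A. norm_plus A f \<le> 1}. cmod (\<phi> f))"

definition embed :: "'h::complex_hilbert graph \<Rightarrow> 'h \<Rightarrow> 'h \<Rightarrow> complex" where
  "embed A h = (\<lambda>f. if f \<in> H_plus A then cinner h f else 0)"

text \<open>Operators from \<open>H_+\<close> to \<open>H_-\<close> are functions whose values outside \<open>H_+\<close> are irrelevant.\<close>

type_synonym 'h rigged_op = "'h \<Rightarrow> 'h \<Rightarrow> complex"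

definition bounded_rigged_op :: "'h::complex_hilbert graph \<Rightarrow> 'h rigged_op \<Rightarrow> bool" where
  "bounded_rigged_op A B \<longleftrightarrow>
     (\<forall>f\<in>H_plus A. B f \<in> H_minus A) \<and>
     (\<forall>f\<in>H_plus A. \<forall>g\<in>H_plus A. B (f + g) = (\<lambda>h. B f h + B g h)) \<and>
     (\<forall>c. \<forall>f\<in>H_plus A. B (c *\<^sub>C f) = (\<lambda>h. c * B f h)) \<and>
     (\<exists>C. \<forall>f\<in>H_plus A. norm_minus A (B f) \<le> C * norm_plus A f)"

text \<open>\<open>(B\<^sup>* g, f) = (g, B f)\<close>, the conjugate of \<open>(B f, g)\<close>.\<close>

definition rigged_adjoint :: "'h::complex_hilbert graph \<Rightarrow> 'h rigged_op \<Rightarrow> 'h rigged_op" where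
  "rigged_adjoint A B = (\<lambda>g f. if f \<in> H_plus A then cnj (B f g) else 0)"

definition rigged_Re :: "'h::complex_hilbert graph \<Rightarrow> 'h rigged_op \<Rightarrow> 'h rigged_op" where
  "rigged_Re A B = (\<lambda>f h. (B f h + rigged_adjoint A B f h) / 2)"

definition rigged_Im :: "'h::complex_hilbert graph \<Rightarrow> 'h rigged_op \<Rightarrow> 'h rigged_op" where
  "rigged_Im A B = (\<lambda>f h. (B f h - rigged_adjoint A B f h) / (2 * \<i>))"

definition quasi_kernel :: "'h::complex_hilbert graph \<Rightarrow> 'h rigged_op \<Rightarrow> 'h graph" where
  "quasi_kernel A B = {(f, g). f \<in> H_plus A \<and> B f = embed A g}"

text \<open>\<open>rigged_extends A B S\<close>: for an operator \<open>S\<close> contained in \<open>A\<^sup>*\<close>, \<open>B\<close> extends \<open>S\<close>.\<close>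

definition rigged_extends :: "'h::complex_hilbert graph \<Rightarrow> 'h rigged_op \<Rightarrow> 'h graph \<Rightarrow> bool" where
  "rigged_extends A B S \<longleftrightarrow> (\<forall>(f, g) \<in> S. f \<in> H_plus A \<and> B f = embed A g)"


section \<open>L-systems with input-output space \<open>\<complex>\<close> and \<open>J = 1\<close>\<close>

definition class_Lambda :: "'h::complex_hilbert graph \<Rightarrow> 'h graph set" where
  "class_Lambda A = {T. linear_op T \<and> A \<subseteq> T \<and> T \<subseteq> adjoint A \<and> resolvent_set T \<noteq> {}
     \<and> Domain A = Domain T \<inter> Domain (adjoint T)}"

definition star_extension ::
  "'h::complex_hilbert graph \<Rightarrow> 'h graph \<Rightarrow> 'h rigged_op \<Rightarrow> bool" where
  "star_extension A T B \<longleftrightarrow> bounded_rigged_op A B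
     \<and> rigged_extends A B T \<and> A \<subseteq> T
     \<and> rigged_extends A (rigged_adjoint A B) (adjoint T) \<and> A \<subseteq> adjoint T
     \<and> selfadjoint (quasi_kernel A (rigged_Re A B))"

definition bounded_channel ::
  "'h::complex_hilbert graph \<Rightarrow> (complex \<Rightarrow> 'h \<Rightarrow> complex) \<Rightarrow> bool" where
  "bounded_channel A K \<longleftrightarrow>
     (\<forall>c. K c \<in> H_minus A) \<and>
     (\<forall>c d. K (c + d) = (\<lambda>f. K c f + K d f)) \<and>
     (\<forall>a c. K (a * c) = (\<lambda>f. a * K c f)) \<and>
     (\<exists>C. \<forall>c. norm_minus A (K c) \<le> C * cmod c)"

text \<open>\<open>K\<^sup>* f\<close> is the number \<open>w\<close> with \<open>(K c, f) = (c, w)\<close> for all \<open>c\<close>.\<close>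

definition channel_adjoint :: "(complex \<Rightarrow> 'h \<Rightarrow> complex) \<Rightarrow> 'h \<Rightarrow> complex" where
  "channel_adjoint K f = (THE w. \<forall>c. K c f = cinner c w)"

lemma channel_adjoint_eq:
  assumes "bounded_channel A K"
  shows "channel_adjoint K f = cnj (K 1 f)"
  unfolding channel_adjoint_def
proof (rule the_equality)
  have scale: "\<forall>a c. K (a * c) = (\<lambda>f. a * K c f)"
    using assms unfolding bounded_channel_def by (elim conjE)
  show "\<forall>c. K c f = cinner c (cnj (K 1 f))"
  proof
    fix c
    have "K (c * 1) f = c * K 1 f"
      using scale[THEN spec, THEN spec, of c 1] by (rule fun_cong)
    then show "K c f = cinner c (cnj (K 1 f))"
      by (simp only: cinner_complex_def complex_cnj_cnj mult_1_right)
  qed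
next
  fix w assume "\<forall>c. K c f = cinner c w"
  then have "K 1 f = cinner 1 w" by (rule spec)
  then show "w = cnj (K 1 f)"
    by (simp only: cinner_complex_def complex_cnj_cnj mult_1_left)
qed

text \<open>\<open>L_system A T B K\<close>: \<open>B\<close> and \<open>K\<close> form an L-system over the symmetric operator \<open>A\<close>, with main
  operator \<open>T\<close>.\<close>

definition L_system ::
  "'h::complex_hilbert graph \<Rightarrow> 'h graph \<Rightarrow> 'h rigged_op \<Rightarrow> (complex \<Rightarrow> 'h \<Rightarrow> complex) \<Rightarrow> bool"
where
  "L_system A T B K \<longleftrightarrow>
     closed_densely_defined_symmetric A \<and> deficiency_indices_1_1 A
     \<and> T \<in> class_Lambda A \<and> star_extension A T B \<and> bounded_channel A K
     \<and> (\<forall>f\<in>H_plus A. rigged_Im A B f = K (channel_adjoint K f))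
     \<and> range K = rigged_Im A B ` H_plus A"

definition minimal_L_system ::
  "'h::complex_hilbert graph \<Rightarrow> 'h graph \<Rightarrow> 'h rigged_op \<Rightarrow> (complex \<Rightarrow> 'h \<Rightarrow> complex) \<Rightarrow> bool"
where
  "minimal_L_system A T B K \<longleftrightarrow> L_system A T B K \<and> prime_op A"

text \<open>\<open>K\<^sup>* (Re B - zI)\<^sup>-\<^sup>1 K\<close> acts on \<open>\<complex>\<close> as multiplication by its value at \<open>1\<close>; the vector
  \<open>(Re B - zI)\<^sup>-\<^sup>1 K 1\<close> is the unique \<open>f\<close> in \<open>H_+\<close> with \<open>(Re B) f - z f = K 1\<close> in \<open>H_-\<close>.
  Meaningful only for \<open>z\<close> in the resolvent set of the quasi-kernel of \<open>Re B\<close>, which contains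
  the open upper half-plane.\<close>

definition impedance ::
  "'h::complex_hilbert graph \<Rightarrow> 'h rigged_op \<Rightarrow> (complex \<Rightarrow> 'h \<Rightarrow> complex) \<Rightarrow> complex \<Rightarrow> complex"
where
  "impedance A B K z = channel_adjoint K
     (THE f. f \<in> H_plus A \<and> (\<lambda>h. rigged_Re A B f h - z * embed A f h) = K 1)"


section \<open>Von Neumann parameter, Hypothesis II and the generalized Donoghue class\<close>

definition von_Neumann_parameter ::
  "'h::complex_hilbert graph \<Rightarrow> 'h graph \<Rightarrow> real \<Rightarrow> bool" where
  "von_Neumann_parameter A T \<kappa> \<longleftrightarrow> A \<subseteq> T \<and> maximal_dissipative T \<and> 0 \<le> \<kappa> \<and> \<kappa> < 1 \<and>
     (\<exists>gp \<in> deficiency_space A \<i>. \<exists>gm \<in> deficiency_space A (- \<i>).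
        norm gp = 1 \<and> norm gm = 1 \<and> gp - complex_of_real \<kappa> *\<^sub>C gm \<in> Domain T)"

definition Hypothesis_II ::
  "'h::complex_hilbert graph \<Rightarrow> 'h graph \<Rightarrow> 'h graph \<Rightarrow> real \<Rightarrow> bool" where
  "Hypothesis_II A T Ahat \<kappa> \<longleftrightarrow>
     (\<exists>gp \<in> deficiency_space A \<i>. \<exists>gm \<in> deficiency_space A (- \<i>).
        norm gp = 1 \<and> norm gm = 1 \<and>
        gp + gm \<in> Domain Ahat \<and> gp - complex_of_real \<kappa> *\<^sub>C gm \<in> Domain T)"

definition upper_half_plane :: "complex set" where
  "upper_half_plane = {z. Im z > 0}"

text \<open>Only the values of \<open>M\<close> on the open upper half-plane matter.\<close>

definition Donoghue_inv :: "real \<Rightarrow> (complex \<Rightarrow> complex) \<Rightarrow> bool" where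
  "Donoghue_inv \<kappa> M \<longleftrightarrow>
     M holomorphic_on upper_half_plane \<and> M ` upper_half_plane \<subseteq> upper_half_plane \<and>
     (\<exists>\<mu> :: real measure. sets \<mu> = sets borel \<and> emeasure \<mu> UNIV = \<infinity> \<and>
        (\<integral>\<^sup>+ x. ennreal (1 / (1 + x\<^sup>2)) \<partial>\<mu>) = ennreal ((1 + \<kappa>) / (1 - \<kappa>)) \<and>
        (\<forall>z\<in>upper_half_plane. M z =
           (\<integral>x. 1 / (complex_of_real x - z) - complex_of_real (x / (1 + x\<^sup>2)) \<partial>\<mu>)))"

end

theory Submission
  imports Defs "HOL-Probability.Probability"
begin

text \<open>
  The quasi-kernel \<open>S\<close> of \<open>Re \<A>\<close> is a self-adjoint extension of \<open>A\<close>, so \<open>Re \<A> - A\<^sup>*\<close> has rank one: writing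
  \<open>l = K\<^sup>*\<close>, there is a boundary functional \<open>p\<close> with kernel \<open>Dom S\<close> such that
  \<open>(Re \<A> f, h) = (A\<^sup>* f, h) + p f * cnj (l h)\<close>, and \<open>p = - i l\<close> on \<open>Dom T\<close>. Hence \<open>V z = l f / p f\<close> for any
  nonzero \<open>f\<close> in \<open>ker (A\<^sup>* - z)\<close>, a Weyl function. Evaluating at \<open>z = i\<close> and inserting the boundary condition of
  \<open>g\<^sub>+ - \<kappa> g\<^sub>-\<close> shows that \<open>V i = i (1 + \<kappa>) / (1 - \<kappa>)\<close> holds exactly if \<open>p (g\<^sub>+ + g\<^sub>-) = 0\<close>.

  Membership in the Donoghue class forces this value of \<open>V i\<close> by integration. Conversely, the imaginary value
  \<open>V i\<close> leaves the linear term and finiteness of the measure as the only obstructions in the Nevanlinna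
  representation of \<open>V\<close>. The linear term vanishes because the defect vectors at \<open>iy\<close> tend to \<open>0\<close>, and the mass is infinite because \<open>g\<^sub>+\<close> is not in
  \<open>Dom S\<close>.
\<close>

section \<open>The Herglotz and Nevanlinna representations\<close>

lemma Cauchy_integral_circle_cis:
  fixes g :: "complex \<Rightarrow> complex"
  assumes "continuous_on (cball 0 1) g" "g holomorphic_on ball 0 1" "norm z < 1"
  shows "((\<lambda>t. g (cis t) * (cis t / (cis t - z))) has_integral 2 * pi * g z) {0..2*pi}"
proof -
  have "((\<lambda>u. g u / (u - z)) has_contour_integral (2 * of_real pi * \<i> * g z)) (circlepath 0 1)"
    using Cauchy_integral_circlepath[OF assms(1,2)] assms(3) by simp
  then have "((\<lambda>t. g (cis t) / (cis t - z) * \<i> * cis t) has_integral 2 * of_real pi * \<i> * g z) {0..2*pi}"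
    unfolding circlepath_def by (subst (asm) has_contour_integral_part_circlepath_iff) simp_all
  from has_integral_mult_right[OF this, of "-\<i>"] show ?thesis
    by (simp add: algebra_simps)
qed

text \<open>On the circle the kernel is \<open>2 * cis t / (cis t - z) - 1\<close>, and twice the
  real part is g plus its conjugate. The integral thus splits into three: g contributes
  \<open>g z\<close>, its conjugate contributes \<open>cnj (g 0)\<close>, and the constant
  contributes minus the mean value \<open>Re (g 0)\<close>.\<close>

lemma Schwarz_formula_circle:
  fixes g :: "complex \<Rightarrow> complex"
  assumes cont: "continuous_on (cball 0 1) g" and hol: "g holomorphic_on ball 0 1" and z: "norm z < 1"
  shows "((\<lambda>t. Re (g (cis t)) * ((cis t + z) / (cis t - z)))
          has_integral 2 * pi * (g z - \<i> * Im (g 0))) {0..2*pi}"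
proof -
  have ne: "cis t \<noteq> z" for t
    using z by (metis norm_cis less_irrefl)
  have ne1: "1 - cnj z * u \<noteq> 0" if "norm u \<le> 1" for u
  proof
    assume "1 - cnj z * u = 0"
    then have "norm (cnj z * u) = 1" by (metis eq_iff_diff_eq_0 norm_one)
    moreover have "norm (cnj z * u) \<le> norm z"
      using that by (simp add: norm_mult mult_left_le)
    ultimately show False using z by simp
  qed
  have 1: "((\<lambda>t. g (cis t) * (cis t / (cis t - z))) has_integral 2 * pi * g z) {0..2*pi}"
    by (rule Cauchy_integral_circle_cis[OF cont hol z])
  \<comment> \<open>For u on the circle, the conjugate of u / (u - z) is 1 / (1 -
    \<open>cnj z\<close> u), which is holomorphic in the disc. After conjugation the integral with
    \<open>cnj g\<close> is therefore a Cauchy integral at 0.\<close>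
  have "((\<lambda>t. g (cis t) / (1 - cnj z * cis t) * (cis t / (cis t - 0))) has_integral
          2 * pi * (g 0 / (1 - cnj z * 0))) {0..2*pi}"
  proof (intro Cauchy_integral_circle_cis[of "\<lambda>u. g u / (1 - cnj z * u)"])
    show "continuous_on (cball 0 1) (\<lambda>u. g u / (1 - cnj z * u))"
      using ne1 by (intro continuous_on_divide cont continuous_intros) auto
    show "(\<lambda>u. g u / (1 - cnj z * u)) holomorphic_on ball 0 1"
      using ne1 by (intro holomorphic_on_divide hol holomorphic_intros) auto
  qed simp
  then have "((\<lambda>t. g (cis t) / (1 - cnj z * cis t)) has_integral 2 * pi * g 0) {0..2*pi}"
    by simp
  from has_integral_cnj[THEN iffD2, OF this]
  have "((\<lambda>t. cnj (g (cis t)) / (1 - z * cnj (cis t))) has_integral 2 * pi * cnj (g 0)) {0..2*pi}"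
    by (simp add: o_def)
  moreover have "cnj (g (cis t)) / (1 - z * cnj (cis t)) = cnj (g (cis t)) * (cis t / (cis t - z))" for t
  proof -
    have "cis t * cnj (cis t) = 1" by (simp add: cis_cnj cis_mult)
    then have "cis t - z = cis t * (1 - z * cnj (cis t))" by (simp add: algebra_simps)
    then show ?thesis by simp
  qed
  ultimately have 2: "((\<lambda>t. cnj (g (cis t)) * (cis t / (cis t - z))) has_integral 2 * pi * cnj (g 0)) {0..2*pi}"
    by simp
  have "((\<lambda>t. g (cis t)) has_integral 2 * pi * g 0) {0..2*pi}"
    using Cauchy_integral_circle_cis[OF cont hol, of 0] by simp
  then have "((\<lambda>t. Re (g (cis t))) has_integral 2 * pi * Re (g 0)) {0..2*pi}"
    using has_integral_Re[of "\<lambda>t. g (cis t)" "2 * pi * g 0"] by simp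
  then have 3: "((\<lambda>t. complex_of_real (Re (g (cis t)))) has_integral complex_of_real (2 * pi * Re (g 0))) {0..2*pi}"
    by (rule has_integral_of_real)
  have "((\<lambda>t. g (cis t) * (cis t / (cis t - z)) + cnj (g (cis t)) * (cis t / (cis t - z)) - Re (g (cis t)))
     has_integral 2 * pi * g z + 2 * pi * cnj (g 0) - 2 * pi * Re (g 0)) {0..2*pi}"
    using has_integral_diff[OF has_integral_add[OF 1 2] 3] by simp
  moreover have "g (cis t) * (cis t / (cis t - z)) + cnj (g (cis t)) * (cis t / (cis t - z)) - Re (g (cis t))
     = Re (g (cis t)) * ((cis t + z) / (cis t - z))" for t
  proof -
    have "g (cis t) * (cis t / (cis t - z)) + cnj (g (cis t)) * (cis t / (cis t - z))
      = (g (cis t) + cnj (g (cis t))) * (cis t / (cis t - z))" by (simp only: distrib_right)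
    also have "\<dots> = Re (g (cis t)) * (2 * cis t / (cis t - z))" by (simp add: complex_add_cnj)
    finally show ?thesis using ne[of t] by (simp add: field_simps)
  qed
  moreover have "2 * pi * g z + 2 * pi * cnj (g 0) - 2 * pi * Re (g 0) = 2 * pi * (g z - \<i> * Im (g 0))"
    by (simp add: complex_eq_iff algebra_simps)
  ultimately show ?thesis by simp
qed

text \<open>The dilations F (r z) with r < 1 extend continuously to the circle, so the Schwarz
  formula writes each of them as an integral against the density Re F (r u) / 2 pi. By F 0 = 1 these
  densities have mass one, and Helly selection gives a weakly convergent subsequence. For fixed z
  the kernel is bounded and continuous in t, so the formula passes to the limit.\<close>

lemma Herglotz_circle:
  assumes hol: "F holomorphic_on ball 0 1" and pos: "\<And>z. norm z < 1 \<Longrightarrow> Re (F z) \<ge> 0" and F0: "F 0 = 1"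
  obtains \<nu> :: "real measure" where "real_distribution \<nu>"
    "\<And>z. norm z < 1 \<Longrightarrow> F z = (\<integral>t. (cis t + z) / (cis t - z) \<partial>\<nu>)"
proof -
  \<comment> \<open>The shift by 2 keeps every radius strictly between 0 and 1, already for n =
    0.\<close>
  define r where "r n = 1 - 1 / (real n + 2)" for n :: nat
  have r: "0 < r n" "r n < 1" for n by (auto simp: r_def field_simps)
  have "r \<longlonglongrightarrow> 1 - 0" unfolding r_def
    by (intro tendsto_intros, real_asymp)
  then have rlim: "r \<longlonglongrightarrow> 1" by simp
  define G where "G n z = F (r n * z)" for n and z :: complex
  have Gin: "norm (r n * z) < 1" if "norm z \<le> 1" for n and z :: complex
  proof -
    have "r n * norm z \<le> r n * 1" using that r[of n] by (intro mult_left_mono) auto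
    then have "r n * norm z < 1" using r(2)[of n] by linarith
    then show ?thesis using r(1)[of n] by (simp add: norm_mult)
  qed
  have Gcont: "continuous_on (cball 0 1) (G n)" for n unfolding G_def
    by (rule continuous_on_compose2[OF holomorphic_on_imp_continuous_on[OF hol]])
       (intro continuous_intros, use Gin in \<open>fastforce simp del: norm_mult\<close>)
  have Ghol: "G n holomorphic_on ball 0 1" for n
    unfolding G_def
    by (rule holomorphic_on_compose_gen[OF _ hol, unfolded o_def])
      (intro holomorphic_intros, use Gin in \<open>fastforce simp del: norm_mult\<close>)
  define d where "d n t = (indicator {0..2*pi} t * Re (G n (cis t)) / (2*pi))" for n and t :: real
  have contcis: "continuous_on UNIV (\<lambda>t. Re (G n (cis t)))" for n
    by (intro continuous_intros continuous_on_compose2[OF Gcont]) auto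
  have [measurable]: "(\<lambda>t. Re (G n (cis t))) \<in> borel_measurable borel" for n
    using contcis by (rule borel_measurable_continuous_onI)
  have [measurable]: "d n \<in> borel_measurable borel" for n
    unfolding d_def by measurable
  have Gpos: "Re (G n (cis t)) \<ge> 0" for n t unfolding G_def by (rule pos, rule Gin) simp
  have dpos: "d n t \<ge> 0" for n t using Gpos by (simp add: d_def)
  define \<mu> where "\<mu> n = density lborel (\<lambda>t. ennreal (d n t))" for n
  have dint: "has_bochner_integral lborel (\<lambda>t. d n t *\<^sub>R ((cis t + z) / (cis t - z))) (G n z - \<i> * Im (G n 0))"
    if z: "norm z < 1" for n z
  proof -
    have ne: "cis t \<noteq> z" for t
      using z by (metis norm_cis less_irrefl)
    have I: "((\<lambda>t. Re (G n (cis t)) * ((cis t + z) / (cis t - z)))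
          has_integral 2 * pi * (G n z - \<i> * Im (G n 0))) {0..2*pi}"
      by (rule Schwarz_formula_circle[OF Gcont Ghol z])
    have "continuous_on {0..2*pi} (\<lambda>t. Re (G n (cis t)) * ((cis t + z) / (cis t - z)))"
      using ne by (intro continuous_intros continuous_on_subset[OF contcis]) auto
    then have "set_integrable lborel {0..2*pi} (\<lambda>t. Re (G n (cis t)) * ((cis t + z) / (cis t - z)))"
      by (rule borel_integrable_atLeastAtMost')
    then have "has_bochner_integral lborel (\<lambda>t. indicator {0..2*pi} t *\<^sub>R (Re (G n (cis t)) * ((cis t + z) / (cis t - z))))
        (2 * pi * (G n z - \<i> * Im (G n 0)))"
      using set_borel_integral_eq_integral[of "{0..2*pi}" "(\<lambda>t. Re (G n (cis t)) * ((cis t + z) / (cis t - z)))"] I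
      by (simp add: has_bochner_integral_iff set_integrable_def set_lebesgue_integral_def integral_unique)
    from has_bochner_integral_mult_left[OF this, of "1 / (2*pi)"]
    have "has_bochner_integral lborel
        (\<lambda>t. (indicator {0..2*pi} t *\<^sub>R (Re (G n (cis t)) * ((cis t + z) / (cis t - z)))) * (1 / (2*pi)))
        ((2 * pi * (G n z - \<i> * Im (G n 0))) * (1 / (2*pi)))" by simp
    moreover have "(indicator {0..2*pi} t *\<^sub>R (Re (G n (cis t)) * ((cis t + z) / (cis t - z)))) * (1 / (2*pi))
        = d n t *\<^sub>R ((cis t + z) / (cis t - z))" for t
      by (simp add: d_def scaleR_conv_of_real mult.commute mult.left_commute)
    moreover have "(2 * pi * w) * (1 / (2*pi)) = w" for w :: complex
      by simp
    ultimately show ?thesis by simp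
  qed
  have F0': "G n 0 = 1" for n by (simp add: G_def F0)
  have bd: "has_bochner_integral lborel (d n) 1" for n
  proof -
    have "has_bochner_integral lborel (\<lambda>t. complex_of_real (d n t)) 1"
      using dint[of 0 n] by (simp add: F0' scaleR_conv_of_real)
    then show ?thesis
      using has_bochner_integral_Re[of lborel "\<lambda>t. complex_of_real (d n t)" 1] by simp
  qed
  have em: "emeasure (\<mu> n) X = (\<integral>\<^sup>+t. ennreal (d n t) * indicator X t \<partial>lborel)" if "X \<in> sets borel" for n X
    unfolding \<mu>_def using that by (simp add: emeasure_density)
  have nn1: "(\<integral>\<^sup>+t. ennreal (d n t) \<partial>lborel) = 1" for n
    using bd[of n] dpos by (subst nn_integral_eq_integral) (auto simp: has_bochner_integral_iff)
  have rd: "real_distribution (\<mu> n)" for n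
  proof -
    have "emeasure (\<mu> n) UNIV = 1" using em[of UNIV n] nn1 by simp
    then show ?thesis
      unfolding real_distribution_def real_distribution_axioms_def
      by (auto intro!: prob_spaceI simp: \<mu>_def)
  qed
  \<comment> \<open>Tightness is phrased with left-open intervals; starting at -1 makes the interval
    contain 0, so one interval carries the whole mass for all n.\<close>
  have full: "measure (\<mu> n) {-1<..2*pi} = 1" for n
  proof -
    have "emeasure (\<mu> n) {-1<..2*pi} = (\<integral>\<^sup>+t. ennreal (d n t) * indicator {-1<..2*pi} t \<partial>lborel)"
      by (rule em) simp
    also have "\<dots> = (\<integral>\<^sup>+t. ennreal (d n t) \<partial>lborel)"
      by (rule nn_integral_cong) (auto simp: d_def indicator_def)
    finally show ?thesis by (simp add: nn1 measure_def)
  qed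
  have tight: "tight \<mu>"
    unfolding tight_def
  proof (intro conjI allI impI)
    fix e :: real assume "e > 0"
    then show "\<exists>a b. a < b \<and> (\<forall>n. 1 - e < measure (\<mu> n) {a<..b})"
      using full pi_gt_zero by (intro exI[of _ "-1"] exI[of _ "2*pi"] conjI allI) (linarith, simp)
  qed (rule rd)
  obtain s \<nu> where s: "strict_mono s" and \<nu>: "real_distribution \<nu>" and wc: "weak_conv_m (\<mu> \<circ> s) \<nu>"
    using tight_imp_convergent_subsubsequence[OF tight, of id] by (auto simp: strict_mono_def)
  show thesis
  proof (rule that[OF \<nu>])
    fix z :: complex assume z: "norm z < 1"
    have ne: "cis t \<noteq> z" for t
      using z by (metis norm_cis less_irrefl)
    have cont: "isCont (\<lambda>t. (cis t + z) / (cis t - z)) t" for t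
    proof -
      have "continuous_on UNIV (\<lambda>t. (cis t + z) / (cis t - z))"
        using ne by (intro continuous_intros) auto
      then show ?thesis by (simp add: continuous_on_eq_continuous_at)
    qed
    have bnd: "norm ((cis t + z) / (cis t - z)) \<le> 2 / (1 - norm z)" for t
    proof -
      have "norm (cis t + z) \<le> 2" using norm_triangle_ineq[of "cis t" z] z by simp
      moreover have "norm (cis t - z) \<ge> 1 - norm z" using norm_triangle_ineq2[of "cis t" z] by simp
      ultimately show ?thesis using z unfolding norm_divide by (intro frac_le) auto
    qed
    have "(\<lambda>n. integral\<^sup>L ((\<mu> \<circ> s) n) (\<lambda>t. (cis t + z) / (cis t - z)))
       \<longlonglongrightarrow> integral\<^sup>L \<nu> (\<lambda>t. (cis t + z) / (cis t - z))"
      by (rule weak_conv_imp_integral_bdd_continuous_conv[OF _ \<nu> wc cont bnd]) (simp add: rd)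
    moreover have "integral\<^sup>L (\<mu> n) (\<lambda>t. (cis t + z) / (cis t - z)) = G n z" for n
    proof -
      have m: "(\<lambda>t. (cis t + z) / (cis t - z)) \<in> borel_measurable lborel"
        using cont by (simp add: borel_measurable_continuous_onI continuous_at_imp_continuous_on)
      have "integral\<^sup>L (\<mu> n) (\<lambda>t. (cis t + z) / (cis t - z)) =
          integral\<^sup>L lborel (\<lambda>t. d n t *\<^sub>R ((cis t + z) / (cis t - z)))"
        unfolding \<mu>_def by (rule integral_density[OF m]) (auto simp: dpos)
      then show ?thesis using dint[OF z, of n] by (simp add: has_bochner_integral_iff F0')
    qed
    ultimately have A: "(\<lambda>n. G (s n) z) \<longlonglongrightarrow> integral\<^sup>L \<nu> (\<lambda>t. (cis t + z) / (cis t - z))"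
      by simp
    have "isCont F z" using hol z
      by (meson continuous_on_eq_continuous_at holomorphic_on_imp_continuous_on mem_ball_0 open_ball)
    moreover have "(\<lambda>n. complex_of_real (r (s n)) * z) \<longlonglongrightarrow> of_real 1 * z"
      using LIMSEQ_subseq_LIMSEQ[OF rlim s] by (intro tendsto_intros) (simp add: o_def)
    ultimately have "(\<lambda>n. G (s n) z) \<longlonglongrightarrow> F z"
      unfolding G_def using isCont_tendsto_compose[of z F] by fastforce
    with A show "F z = integral\<^sup>L \<nu> (\<lambda>t. (cis t + z) / (cis t - z))"
      by (rule LIMSEQ_unique[rotated])
  qed
qed

text \<open>The Cayley transform moves V to the disc, where division by i m gives positive real part
  and value 1 at 0, so Herglotz applies. Transporting the measure back to the line leaves one
  exceptional boundary point, the one sent to infinity: its mass would be a linear term of V, which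
  \<open>sublinear\<close> excludes. The assumption \<open>unbdd\<close> excludes a finite
  measure.\<close>

lemma Nevanlinna_representation:
  fixes V :: "complex \<Rightarrow> complex" and m :: real
  assumes hol: "V holomorphic_on {z. Im z > 0}"
    and pos: "\<And>z. Im z > 0 \<Longrightarrow> Im (V z) \<ge> 0"
    and Vi: "V \<i> = \<i> * m" and m: "m > 0"
    and sublinear: "((\<lambda>y. Im (V (\<i> * of_real y)) / y) \<longlongrightarrow> 0) at_top"
    and unbdd: "\<And>C. \<exists>y>0. y * Im (V (\<i> * of_real y)) > C"
  obtains \<mu> :: "real measure" where "sets \<mu> = sets borel" "emeasure \<mu> UNIV = \<infinity>"
    "(\<integral>\<^sup>+ x. ennreal (1 / (1 + x\<^sup>2)) \<partial>\<mu>) = ennreal m"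
    "\<And>z. Im z > 0 \<Longrightarrow> V z =
       (\<integral>x. 1 / (complex_of_real x - z) - complex_of_real (x / (1 + x\<^sup>2)) \<partial>\<mu>)"
proof -
  define F where "F w = V (\<i> * (1 - w) / (1 + w)) / (\<i> * m)" for w
  have ne1: "1 + w \<noteq> 0" if "norm w < 1" for w :: complex
    using that by (metis add.inverse_unique norm_minus_cancel norm_one less_irrefl)
  have uhp: "Im (\<i> * (1 - w) / (1 + w)) > 0" if w: "norm w < 1" for w
  proof -
    have "(Re w)\<^sup>2 + (Im w)\<^sup>2 < 1"
      using w by (simp add: cmod_def)
    moreover have "(1 + Re w)\<^sup>2 + (Im w)\<^sup>2 > 0"
      using ne1[OF w] by (metis complex_eq_iff Re_complex_of_real one_complex.simps plus_complex.simps zero_complex.simps sum_power2_gt_zero_iff add_0)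
    ultimately show ?thesis
      by (simp add: Im_divide power2_eq_square algebra_simps)
  qed
  have Fhol: "F holomorphic_on ball 0 1"
    unfolding F_def
    by (rule holomorphic_on_divide[OF holomorphic_on_compose_gen[OF _ hol, unfolded o_def]])
      (use uhp ne1 m in \<open>auto intro!: holomorphic_intros\<close>)
  have Fpos: "Re (F w) \<ge> 0" if "norm w < 1" for w
    using pos[OF uhp[OF that]] m by (simp add: F_def Re_divide power2_eq_square)
  have F0: "F 0 = 1" using Vi m by (simp add: F_def)
  obtain \<nu> :: "real measure" where \<nu>: "real_distribution \<nu>"
    and rep: "\<And>w. norm w < 1 \<Longrightarrow> F w = (\<integral>t. (cis t + w) / (cis t - w) \<partial>\<nu>)"
    using Herglotz_circle[OF Fhol Fpos F0] by blast
  interpret \<nu>: real_distribution \<nu> by fact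
  define w where "w z = (\<i> - z) / (\<i> + z)" for z
  have iz: "\<i> + z \<noteq> 0" if "Im z > 0" for z
    using that by (auto simp: complex_eq_iff)
  have w1: "norm (w z) < 1" if "Im z > 0" for z
  proof -
    have "(Re (\<i> - z))\<^sup>2 + (Im (\<i> - z))\<^sup>2 < (Re (\<i> + z))\<^sup>2 + (Im (\<i> + z))\<^sup>2"
      using that by (simp add: power2_eq_square algebra_simps)
    then have "norm (\<i> - z) < norm (\<i> + z)"
      by (simp add: cmod_def)
    then show ?thesis using iz[OF that] by (simp add: w_def norm_divide)
  qed
  have winv: "\<i> * (1 - w z) / (1 + w z) = z" if "Im z > 0" for z
  proof -
    have "1 - w z = 2 * z / (\<i> + z)" "1 + w z = 2 * \<i> / (\<i> + z)"
      using iz[OF that] by (simp_all add: w_def field_simps)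
    then show ?thesis using iz[OF that] by simp
  qed
  define k where "k z t = (cis t + w z) / (cis t - w z)" for z and t :: real
  have wne: "cis t \<noteq> w z" if "Im z > 0" for z t
    using w1[OF that] by (metis norm_cis less_irrefl)
  have kint: "integrable \<nu> (k z)" if z: "Im z > 0" for z
  proof (rule \<nu>.integrable_const_bound)
    have "norm (k z t) \<le> 2 / (1 - norm (w z))" for t
    proof -
      have "norm (cis t + w z) \<le> 2" using norm_triangle_ineq[of "cis t" "w z"] w1[OF z] by simp
      moreover have "norm (cis t - w z) \<ge> 1 - norm (w z)" using norm_triangle_ineq2[of "cis t" "w z"] by simp
      ultimately show ?thesis using w1[OF z] unfolding norm_divide k_def by (intro frac_le) auto
    qed
    then show "AE t in \<nu>. norm (k z t) \<le> 2 / (1 - norm (w z))" by simp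
    have "continuous_on UNIV (k z)" unfolding k_def
      using wne[OF z] by (intro continuous_intros) auto
    then show "k z \<in> borel_measurable \<nu>"
      by (simp add: borel_measurable_continuous_onI)
  qed
  have Vk: "V z = \<i> * m * (\<integral>t. k z t \<partial>\<nu>)" if z: "Im z > 0" for z
    using rep[OF w1[OF z]] m unfolding F_def winv[OF z] k_def by (simp add: field_simps)
  have kRe: "Re (k z t) \<ge> 0" if "Im z > 0" for z t
  proof -
    have "(Re (w z))\<^sup>2 + (Im (w z))\<^sup>2 < 1"
      using w1[OF that] by (simp add: cmod_def)
    moreover have "(cos t)\<^sup>2 + (sin t)\<^sup>2 = 1" by simp
    ultimately have "(cos t + Re (w z)) * (cos t - Re (w z)) + (sin t + Im (w z)) * (sin t - Im (w z)) \<ge> 0"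
      by (simp add: power2_eq_square algebra_simps)
    then show ?thesis
      by (simp add: k_def Re_divide)
  qed
  \<comment> \<open>These angles give the boundary point -1, which the Cayley map sends to infinity.
    At iy the kernel equals y there, so mass on N would make Im V (iy) grow at least
    linearly.\<close>
  define N where "N = {t :: real. cis t = -1}"
  have N[measurable]: "N \<in> sets borel"
    unfolding N_def by (intro borel_closed closed_Collect_eq continuous_intros)
  have kN: "k (\<i> * of_real y) t = of_real y" if "y > 0" "t \<in> N" for y t
  proof -
    have z: "Im (\<i> * of_real y) > 0" using that by simp
    have "1 + w (\<i> * of_real y) \<noteq> 0" using ne1[OF w1[OF z]] .
    moreover have "\<i> * (1 - w (\<i> * of_real y)) = \<i> * of_real y * (1 + w (\<i> * of_real y))"
      using winv[OF z] calculation by (simp add: field_simps)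
    then have "(1 - w (\<i> * of_real y)) = of_real y * (1 + w (\<i> * of_real y))"
      by (metis complex_i_not_zero mult.assoc mult_cancel_left)
    moreover have "cis t = -1" using that by (simp add: N_def)
    moreover have "k (\<i> * of_real y) t = (1 - w (\<i> * of_real y)) / (1 + w (\<i> * of_real y))"
      unfolding k_def \<open>cis t = -1\<close>
      using minus_divide_divide[of "1 - w (\<i> * of_real y)" "1 + w (\<i> * of_real y)"] by simp
    ultimately show ?thesis by simp
  qed
  have "measure \<nu> N \<le> 0"
  proof (rule tendsto_lowerbound)
    show "((\<lambda>y. Im (V (\<i> * of_real y)) / y / m) \<longlongrightarrow> 0) at_top"
      using tendsto_divide[OF sublinear tendsto_const[of m]] m by simp
    show "\<forall>\<^sub>F y in at_top. measure \<nu> N \<le> Im (V (\<i> * of_real y)) / y / m"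
      using eventually_gt_at_top[of 0]
    proof eventually_elim
      fix y :: real assume y: "0 < y"
      then have z: "Im (\<i> * of_real y) > 0" by simp
      have "y * measure \<nu> N = (\<integral>t. y * indicator N t \<partial>\<nu>)" by simp
      also have "\<dots> \<le> (\<integral>t. Re (k (\<i> * of_real y) t) \<partial>\<nu>)"
      proof (rule integral_mono)
        show "integrable \<nu> (\<lambda>t. y * indicator N t)"
          by (rule \<nu>.integrable_const_bound[of _ y]) (use y in \<open>auto simp: indicator_def\<close>)
        show "integrable \<nu> (\<lambda>t. Re (k (\<i> * of_real y) t))"
          using kint[OF z] by simp
        show "y * indicator N t \<le> Re (k (\<i> * of_real y) t)" for t
          using kRe[OF z] kN[OF y] by (simp add: indicator_def)
      qed
      also have "\<dots> = Re (\<integral>t. k (\<i> * of_real y) t \<partial>\<nu>)"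
        using kint[OF z] by simp
      also have "\<dots> = Im (V (\<i> * of_real y)) / m"
        using Vk[OF z] m by simp
      finally show "measure \<nu> N \<le> Im (V (\<i> * of_real y)) / y / m"
        using y m by (simp add: field_simps)
    qed
  qed simp
  then have "emeasure \<nu> N = 0"
    by (simp add: \<nu>.emeasure_eq_measure antisym)
  then have AEN: "AE t in \<nu>. t \<notin> N"
    by (intro AE_not_in) (simp add: null_sets_def)
  \<comment> \<open>This is tan (t / 2), the boundary value of the Cayley map at
    \<open>cis t\<close>. On N the division by zero yields 0, which is harmless because N is a null
    set.\<close>
  define x where "x t = sin t / (1 + cos t)" for t :: real
  have [measurable]: "x \<in> borel_measurable borel"
    unfolding x_def by measurable
  have kx: "\<i> * k z t = (1 + x t * z) / (x t - z)" if z: "Im z > 0" and t: "t \<notin> N" for z :: complex and t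
  proof -
    have c: "1 + cos t \<noteq> 0"
    proof
      assume "1 + cos t = 0"
      then have "cos t = -1" by simp
      moreover from this have "sin t = 0"
        using sin_cos_squared_add[of t] by simp
      ultimately show False using t by (simp add: N_def complex_eq_iff)
    qed
    have d: "1 - \<i> * x t \<noteq> 0" by (simp add: complex_eq_iff)
    have "cis t * (1 + cos t - \<i> * sin t) = (1 + cos t + \<i> * sin t)"
      using sin_cos_squared_add[of t] by (simp add: complex_eq_iff power2_eq_square algebra_simps)
    moreover have "of_real (sin t) = of_real (x t) * complex_of_real (1 + cos t)"
      using c unfolding x_def of_real_mult[symmetric] by simp
    ultimately have "cis t * (1 - \<i> * x t) * complex_of_real (1 + cos t) = (1 + \<i> * x t) * complex_of_real (1 + cos t)"
      by (simp add: algebra_simps)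
    then have ct: "cis t * (1 - \<i> * x t) = 1 + \<i> * x t"
      using c by (metis mult_cancel_right of_real_eq_0_iff)
    have xz: "x t - z \<noteq> 0" using z by (auto simp: complex_eq_iff)
    \<comment> \<open>Extending the fraction by this product clears both Cayley denominators, since
      \<open>cis t\<close> is (1 + i x) / (1 - i x) and \<open>w z\<close> is (i - z) / (i +
      z).\<close>
    have "k z t = (cis t + w z) * ((1 - \<i> * x t) * (\<i> + z)) / ((cis t - w z) * ((1 - \<i> * x t) * (\<i> + z)))"
      using d iz[OF z] unfolding k_def by simp
    also have "(cis t + w z) * ((1 - \<i> * x t) * (\<i> + z))
        = (cis t * (1 - \<i> * x t)) * (\<i> + z) + (1 - \<i> * x t) * (w z * (\<i> + z))"
      by (simp add: algebra_simps)
    also have "(cis t - w z) * ((1 - \<i> * x t) * (\<i> + z))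
        = (cis t * (1 - \<i> * x t)) * (\<i> + z) - (1 - \<i> * x t) * (w z * (\<i> + z))"
      by (simp add: algebra_simps)
    also have "w z * (\<i> + z) = \<i> - z"
      using iz[OF z] by (simp add: w_def)
    also note ct
    also have "(1 + \<i> * x t) * (\<i> + z) + (1 - \<i> * x t) * (\<i> - z) = 2 * \<i> * (1 + x t * z)"
      by (simp add: algebra_simps)
    also have "(1 + \<i> * x t) * (\<i> + z) - (1 - \<i> * x t) * (\<i> - z) = - 2 * (x t - z)"
      by (simp add: algebra_simps)
    finally have "k z t = 2 * \<i> * (1 + x t * z) / (- 2 * (x t - z))" .
    moreover have "\<i> * (2 * \<i> * a / (- 2 * b)) = a / b" for a b :: complex
      by simp
    ultimately show ?thesis by (simp only:)
  qed
  define \<rho> where "\<rho> = distr \<nu> borel x"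
  interpret \<rho>: real_distribution \<rho>
    unfolding \<rho>_def by (rule \<nu>.real_distribution_distr) simp
  \<comment> \<open>The weight is dictated by (1 + x z) / (x - z) = (1 + x^2) (1 / (x - z) - x / (1
    + x^2)). It also turns the probability measure into one whose integral of 1 / (1 + x^2) is
    m.\<close>
  define \<mu> where "\<mu> = density \<rho> (\<lambda>x. ennreal (m * (1 + x\<^sup>2)))"
  have sets: "sets \<mu> = sets borel" by (simp add: \<mu>_def)
  have V: "V z = (\<integral>x. 1 / (complex_of_real x - z) - complex_of_real (x / (1 + x\<^sup>2)) \<partial>\<mu>)"
    if z: "Im z > 0" for z :: complex
  proof -
    have xz: "complex_of_real x \<noteq> z" for x using z by auto
    have q: "1 + complex_of_real x * complex_of_real x \<noteq> 0" for x
      by (metis of_real_1 of_real_add of_real_eq_0_iff of_real_mult power2_eq_square sum_power2_eq_zero_iff zero_neq_one one_power2)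
    have "(\<integral>x. 1 / (complex_of_real x - z) - complex_of_real (x / (1 + x\<^sup>2)) \<partial>\<mu>)
       = (\<integral>x. (m * (1 + x\<^sup>2)) *\<^sub>R (1 / (complex_of_real x - z) - complex_of_real (x / (1 + x\<^sup>2))) \<partial>\<rho>)"
      unfolding \<mu>_def using m by (intro integral_density) auto
    also have "\<dots> = (\<integral>x. m * ((1 + x * z) / (x - z)) \<partial>\<rho>)"
    proof (rule Bochner_Integration.integral_cong[OF refl])
      fix x :: real
      have "(1 + complex_of_real x * x) * (1 / (x - z) - x / (1 + complex_of_real x * x)) = (1 + x * z) / (x - z)"
        using xz[of x] q[of x] by (simp add: divide_simps) (simp add: algebra_simps)
      then show "(m * (1 + x\<^sup>2)) *\<^sub>R (1 / (complex_of_real x - z) - complex_of_real (x / (1 + x\<^sup>2)))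
         = m * ((1 + x * z) / (x - z))"
        by (simp add: scaleR_conv_of_real power2_eq_square mult.assoc)
    qed
    also have "\<dots> = (\<integral>t. m * ((1 + x t * z) / (x t - z)) \<partial>\<nu>)"
      unfolding \<rho>_def by (rule integral_distr) simp_all
    also have "\<dots> = (\<integral>t. \<i> * m * k z t \<partial>\<nu>)"
    proof (rule integral_cong_AE)
      show "AE t in \<nu>. m * ((1 + x t * z) / (x t - z)) = \<i> * m * k z t"
        using AEN by eventually_elim (simp add: kx[OF z, symmetric])
    qed (use kint[OF z] in auto)
    also have "\<dots> = V z" using Vk[OF z] by simp
    finally show ?thesis ..
  qed
  have mass: "(\<integral>\<^sup>+ x. ennreal (1 / (1 + x\<^sup>2)) \<partial>\<mu>) = ennreal m"
  proof -
    have q: "1 + x\<^sup>2 > 0" for x :: real by (simp add: add_pos_nonneg)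
    have "(\<integral>\<^sup>+ x. ennreal (1 / (1 + x\<^sup>2)) \<partial>\<mu>) = (\<integral>\<^sup>+ x. ennreal (m * (1 + x\<^sup>2)) * ennreal (1 / (1 + x\<^sup>2)) \<partial>\<rho>)"
      unfolding \<mu>_def by (rule nn_integral_density) simp_all
    also have "\<dots> = (\<integral>\<^sup>+ x. ennreal m \<partial>\<rho>)"
    proof (rule nn_integral_cong)
      fix x :: real
      show "ennreal (m * (1 + x\<^sup>2)) * ennreal (1 / (1 + x\<^sup>2)) = ennreal m"
        using m q[of x] by (subst ennreal_mult[symmetric]) auto
    qed
    finally show ?thesis using \<rho>.emeasure_space_1 by (simp add: \<rho>_def)
  qed
  \<comment> \<open>At z = iy the kernel has imaginary part y / (x^2 + y^2), at most 1 / y. A finite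
    mass would thus bound y Im V (iy).\<close>
  have inf: "emeasure \<mu> UNIV = \<infinity>"
  proof (rule ccontr)
    assume fin: "emeasure \<mu> UNIV \<noteq> \<infinity>"
    interpret \<mu>: finite_measure \<mu>
      by standard (use fin sets_eq_imp_space_eq[OF sets] in simp)
    obtain y where y: "y > 0" and big: "y * Im (V (\<i> * of_real y)) > measure \<mu> UNIV"
      using unbdd by blast
    let ?g = "\<lambda>x. 1 / (complex_of_real x - \<i> * of_real y) - complex_of_real (x / (1 + x\<^sup>2))"
    have gIm: "Im (?g x) = y / (x\<^sup>2 + y\<^sup>2)" for x
      by (simp add: Im_divide)
    have gbd: "norm (?g x) \<le> 1 / y + 1" for x
    proof -
      have "norm (complex_of_real x - \<i> * of_real y) \<ge> \<bar>Im (complex_of_real x - \<i> * of_real y)\<bar>"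
        by (rule abs_Im_le_cmod)
      then have "norm (1 / (complex_of_real x - \<i> * of_real y)) \<le> 1 / y"
        using y by (simp add: norm_divide frac_le)
      moreover have "\<bar>x\<bar> \<le> 1 + x\<^sup>2"
        using zero_le_power2[of "\<bar>x\<bar> - 1"] by (simp add: power2_eq_square algebra_simps abs_mult_self_eq)
      then have "norm (complex_of_real (x / (1 + x\<^sup>2))) \<le> 1"
        unfolding norm_of_real abs_divide by (simp add: add_pos_nonneg)
      ultimately show ?thesis
        using norm_triangle_ineq4[of "1 / (complex_of_real x - \<i> * of_real y)" "complex_of_real (x / (1 + x\<^sup>2))"] by linarith
    qed
    have gint: "integrable \<mu> ?g"
      by (rule \<mu>.integrable_const_bound[of _ "1 / y + 1"]) (use gbd in \<open>auto simp: measurable_cong_sets[OF sets refl]\<close>)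
    have "Im (V (\<i> * of_real y)) = Im (\<integral>x. ?g x \<partial>\<mu>)"
      using V[of "\<i> * of_real y"] y by simp
    also have "\<dots> = (\<integral>x. Im (?g x) \<partial>\<mu>)"
      by (rule integral_Im[OF gint, symmetric])
    also have "\<dots> \<le> (\<integral>x. 1 / y \<partial>\<mu>)"
    proof (rule integral_mono)
      show "Im (?g x) \<le> 1 / y" for x
        unfolding gIm using y by (simp add: divide_simps power2_eq_square add_nonneg_pos)
      show "integrable \<mu> (\<lambda>x. Im (?g x))" by (rule integrable_Im[OF gint])
    qed simp
    also have "\<dots> = measure \<mu> UNIV / y"
      using sets_eq_imp_space_eq[OF sets] by simp
    finally show False using big y by (simp add: field_simps)
  qed
  show thesis by (rule that[OF sets inf mass V])
qed

section \<open>Hilbert space and Riesz representation\<close>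

lemma cinner_add_right: "cinner x (y + z) = cinner x y + cinner x (z :: 'a::complex_hilbert)"
  by (metis cinner_add_left cinner_commute complex_cnj_add)

lemma cinner_scaleC_right: "cinner x (a *\<^sub>C y) = cnj a * cinner x (y :: 'a::complex_hilbert)"
  by (metis cinner_scaleC_left cinner_commute complex_cnj_mult)

lemma cinner_zero_left [simp]: "cinner 0 (x :: 'a::complex_hilbert) = 0"
  using cinner_add_left[of 0 0 x] by simp

lemma cinner_zero_right [simp]: "cinner (x :: 'a::complex_hilbert) 0 = 0"
  using cinner_add_right[of x 0 0] by simp

lemma cinner_minus_left: "cinner (- x) y = - cinner x (y :: 'a::complex_hilbert)"
  using cinner_add_left[of x "- x" y] by (simp add: eq_neg_iff_add_eq_0 add.commute)

lemma cinner_minus_right: "cinner x (- y) = - cinner x (y :: 'a::complex_hilbert)"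
  using cinner_add_right[of x y "- y"] by (simp add: eq_neg_iff_add_eq_0 add.commute)

lemma cinner_diff_left: "cinner (x - y) z = cinner x z - cinner y (z :: 'a::complex_hilbert)"
  using cinner_add_left[of x "- y" z] by (simp add: cinner_minus_left)

lemma cinner_diff_right: "cinner x (y - z) = cinner x y - cinner x (z :: 'a::complex_hilbert)"
  using cinner_add_right[of x y "- z"] by (simp add: cinner_minus_right)

lemmas cinner_algebra = cinner_add_left cinner_add_right cinner_diff_left cinner_diff_right
  cinner_minus_left cinner_minus_right cinner_scaleC_left cinner_scaleC_right

lemma cinner_Re_commute: "Re (cinner x y) = Re (cinner y (x :: 'a::complex_hilbert))"
  by (subst cinner_commute) simp

lemma norm_eq_Re_cinner: "(norm x)\<^sup>2 = Re (cinner x (x :: 'a::complex_hilbert))"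
  by (simp add: cinner_self)

lemma norm_scaleC: "norm (a *\<^sub>C x) = cmod a * norm (x :: 'a::complex_hilbert)"
proof -
  have "complex_of_real ((norm (a *\<^sub>C x))\<^sup>2) = a * cnj a * complex_of_real ((norm x)\<^sup>2)"
    by (metis cinner_self cinner_scaleC_left cinner_scaleC_right mult.assoc)
  also have "\<dots> = complex_of_real ((cmod a * norm x)\<^sup>2)"
    by (simp add: complex_norm_square power_mult_distrib del: of_real_power)
  finally have "(norm (a *\<^sub>C x))\<^sup>2 = (cmod a * norm x)\<^sup>2"
    using of_real_eq_iff by blast
  then show ?thesis by (simp add: power2_eq_iff_nonneg)
qed

lemma norm_add_square:
  "(norm (x + y))\<^sup>2 = (norm x)\<^sup>2 + 2 * Re (cinner x y) + (norm (y :: 'a::complex_hilbert))\<^sup>2"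
  by (simp add: norm_eq_Re_cinner cinner_algebra cinner_Re_commute[of y x])

lemma parallelogram:
  "(norm (x + y))\<^sup>2 + (norm (x - y))\<^sup>2 = 2 * (norm x)\<^sup>2 + 2 * (norm (y :: 'a::complex_hilbert))\<^sup>2"
  by (simp add: norm_eq_Re_cinner cinner_algebra)

lemma cinner_Cauchy_Schwarz: "cmod (cinner x y) \<le> norm x * norm (y :: 'a::complex_hilbert)"
proof (cases "y = 0")
  case False
  \<comment> \<open>With this coefficient \<open>x + a *\<^sub>C y\<close> is orthogonal to y, so
    its norm is the smallest possible along y.\<close>
  define a where "a = - cinner x y / (norm y)\<^sup>2"
  have n: "norm y > 0" using False by simp
  have "0 \<le> (norm (x + a *\<^sub>C y))\<^sup>2" by simp
  also have "\<dots> = (norm x)\<^sup>2 + 2 * Re (cnj a * cinner x y) + (cmod a * norm y)\<^sup>2"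
    by (simp add: norm_add_square cinner_scaleC_right norm_scaleC)
  also have "cnj a * cinner x y = - complex_of_real ((cmod (cinner x y))\<^sup>2 / (norm y)\<^sup>2)"
    using complex_norm_square[of "cinner x y"] by (simp add: a_def mult.commute)
  also have "cmod a * norm y = cmod (cinner x y) / norm y"
    using n by (simp add: a_def norm_divide norm_mult power2_eq_square)
  finally have "(cmod (cinner x y))\<^sup>2 / (norm y)\<^sup>2 \<le> (norm x)\<^sup>2"
    by (simp add: power_divide)
  then have "(cmod (cinner x y))\<^sup>2 \<le> (norm x * norm y)\<^sup>2"
    using n by (simp add: field_simps power_mult_distrib)
  then show ?thesis by (simp add: power2_le_iff_abs_le abs_le_square_iff)
qed simp

lemma tendsto_cinner_left:
  assumes "(f \<longlongrightarrow> (l :: 'a::complex_hilbert)) F"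
  shows "((\<lambda>x. cinner (f x) y) \<longlongrightarrow> cinner l y) F"
proof -
  have "((\<lambda>x. norm (f x - l) * norm y) \<longlongrightarrow> 0 * norm y) F"
    using assms by (intro tendsto_intros) (simp add: LIM_zero tendsto_norm_zero)
  then have "((\<lambda>x. norm (f x - l) * norm y) \<longlongrightarrow> 0) F" by simp
  then have "((\<lambda>x. cinner (f x) y - cinner l y) \<longlongrightarrow> 0) F"
    by (rule Lim_null_comparison[rotated])
      (simp add: cinner_diff_left[symmetric] cinner_Cauchy_Schwarz)
  then show ?thesis by (rule LIM_zero_cancel)
qed

lemma tendsto_cinner_right:
  assumes "(f \<longlongrightarrow> (l :: 'a::complex_hilbert)) F"
  shows "((\<lambda>x. cinner y (f x)) \<longlongrightarrow> cinner y l) F"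
  using tendsto_cnj[OF tendsto_cinner_left[OF assms, of y]] by (simp flip: cinner_commute)

lemma dense_orthogonal_eq_zero:
  fixes x :: "'a::complex_hilbert"
  assumes "closure D = UNIV" and "\<And>y. y \<in> D \<Longrightarrow> cinner y x = 0"
  shows "x = 0"
proof -
  obtain s where s: "\<And>n. s n \<in> D" "s \<longlonglongrightarrow> x"
    using assms(1) closure_sequential[of x D] by auto
  have "(\<lambda>n. cinner (s n) x) \<longlonglongrightarrow> cinner x x"
    using s(2) by (rule tendsto_cinner_left)
  then have "cinner x x = 0"
    using assms(2)[OF s(1)] by (simp add: LIMSEQ_const_iff)
  then show ?thesis by (simp add: cinner_self)
qed

text \<open>The representing vector minimises \<open>\<parallel>x\<parallel>\<^sup>2 - 2 Re a\<close> over the graph. Working with a graph that is not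
  assumed to be closed or densely defined makes completeness of the domain unnecessary.\<close>

lemma Riesz_representation_graph:
  fixes G :: "('a::complex_hilbert \<times> complex) set"
  assumes zero: "(0, 0) \<in> G"
    and add: "\<And>x a y b. (x, a) \<in> G \<Longrightarrow> (y, b) \<in> G \<Longrightarrow> (x + y, a + b) \<in> G"
    and scale: "\<And>c x a. (x, a) \<in> G \<Longrightarrow> (c *\<^sub>C x, c * a) \<in> G"
    and bound: "\<And>x a. (x, a) \<in> G \<Longrightarrow> cmod a \<le> C * norm x"
  obtains k where "\<And>x a. (x, a) \<in> G \<Longrightarrow> a = cinner x k"
proof -
  define J where "J = (\<lambda>(x :: 'a, a). (norm x)\<^sup>2 - 2 * Re a)"
  define d where "d = Inf (J ` G)"
  \<comment> \<open>Completing the square: \<open>Re a\<close> is at most C times the norm of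
    x.\<close>
  have low: "J q \<ge> - C\<^sup>2" if "q \<in> G" for q
  proof -
    obtain x a where q: "q = (x, a)" by force
    have "Re a \<le> C * norm x" using bound[of x a] that q complex_Re_le_cmod[of a] by simp
    moreover have "0 \<le> (norm x - C)\<^sup>2" by simp
    ultimately show ?thesis by (simp add: J_def q power2_eq_square algebra_simps)
  qed
  have bdd: "bdd_below (J ` G)" using low by (intro bdd_belowI2)
  have dle: "d \<le> J q" if "q \<in> G" for q
    unfolding d_def by (rule cInf_lower[OF _ bdd]) (use that in auto)
  have "\<exists>q\<in>G. J q < d + 1 / real (Suc n)" for n
  proof -
    have "\<exists>r\<in>J ` G. r < d + 1 / real (Suc n)"
      unfolding d_def using zero by (intro cInf_lessD) auto
    then show ?thesis by auto
  qed
  then obtain q where q: "\<And>n. q n \<in> G" "\<And>n. J (q n) < d + 1 / real (Suc n)"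
    by metis
  define x where "x n = fst (q n)" for n
  define a where "a n = snd (q n)" for n
  have xa: "(x n, a n) \<in> G" for n using q(1)[of n] by (simp add: x_def a_def)
  have Jq: "J (q n) = (norm (x n))\<^sup>2 - 2 * Re (a n)" for n
    by (simp add: J_def x_def a_def case_prod_beta)
  \<comment> \<open>The midpoint of two approximate minimisers lies in G, so J is at least d there.
    The parallelogram law turns this into a bound on their distance, which makes the minimising
    sequence Cauchy.\<close>
  have dist2: "(norm (x n - x l))\<^sup>2 \<le> 2 * (1 / real (Suc n) + 1 / real (Suc l))" for n l
  proof -
    have "((1/2) *\<^sub>C (x n + x l), (1/2) * (a n + a l)) \<in> G"
      by (intro scale add xa)
    from dle[OF this] have "d \<le> (norm (x n + x l) / 2)\<^sup>2 - Re (a n + a l)"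
      by (simp add: J_def norm_scaleC norm_divide add_divide_distrib)
    then have "4 * d \<le> (norm (x n + x l))\<^sup>2 - 4 * Re (a n) - 4 * Re (a l)"
      by (simp add: power_divide)
    moreover have "(norm (x j))\<^sup>2 < d + 2 * Re (a j) + 1 / real (Suc j)" for j
      using q(2)[of j] unfolding Jq by linarith
    from this[of n] this[of l]
    have "2 * (norm (x n))\<^sup>2 + 2 * (norm (x l))\<^sup>2 \<le> 4 * d + 4 * Re (a n) + 4 * Re (a l)
        + 2 * (1 / real (Suc n) + 1 / real (Suc l))"
      by argo
    ultimately show ?thesis
      using parallelogram[of "x n" "x l"] by argo
  qed
  have "Cauchy x"
  proof (rule metric_CauchyI)
    fix e :: real assume e: "0 < e"
    obtain M where M: "1 / real (Suc M) < e\<^sup>2 / 4"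
      using nat_approx_posE[of "e\<^sup>2 / 4"] e by auto
    show "\<exists>M. \<forall>m\<ge>M. \<forall>n\<ge>M. dist (x m) (x n) < e"
    proof (intro exI allI impI)
      fix m n assume mn: "M \<le> m" "M \<le> n"
      then have "1 / real (Suc m) \<le> 1 / real (Suc M)" "1 / real (Suc n) \<le> 1 / real (Suc M)"
        by (simp_all add: frac_le)
      then have "(norm (x m - x n))\<^sup>2 < e\<^sup>2" using dist2[of m n] M by argo
      then show "dist (x m) (x n) < e"
        using e by (simp add: dist_norm power2_less_imp_less)
    qed
  qed
  then obtain k where k: "x \<longlonglongrightarrow> k" using Cauchy_convergent convergent_def by blast
  have Re_eq: "Re b = Re (cinner y k)" if yb: "(y, b) \<in> G" for y b
  proof -
    \<comment> \<open>First variation: moving an approximate minimiser by t (y, b) cannot take J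
      below d. In the limit this is a quadratic inequality in t without constant term, which forces
      its linear coefficient to vanish.\<close>
    have ineq: "0 \<le> 2 * t * (Re (cinner y k) - Re b) + t\<^sup>2 * (norm y)\<^sup>2" for t :: real
    proof (rule tendsto_le)
      show "(\<lambda>n. 1 / real (Suc n) + 2 * t * (Re (cinner y (x n)) - Re b) + t\<^sup>2 * (norm y)\<^sup>2) \<longlonglongrightarrow>
          2 * t * (Re (cinner y k) - Re b) + t\<^sup>2 * (norm y)\<^sup>2"
      proof -
        have "(\<lambda>n. Re (cinner (x n) y)) \<longlonglongrightarrow> Re (cinner k y)"
          by (intro tendsto_Re tendsto_cinner_left k)
        then have c: "(\<lambda>n. Re (cinner y (x n))) \<longlonglongrightarrow> Re (cinner y k)"
          by (simp only: cinner_Re_commute[of y])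
        have n: "(\<lambda>n. 1 / real (Suc n)) \<longlonglongrightarrow> 0"
          using LIMSEQ_inverse_real_of_nat by (simp add: inverse_eq_divide)
        have "(\<lambda>n. 1 / real (Suc n) + 2 * t * (Re (cinner y (x n)) - Re b) + t\<^sup>2 * (norm y)\<^sup>2) \<longlonglongrightarrow>
          0 + 2 * t * (Re (cinner y k) - Re b) + t\<^sup>2 * (norm y)\<^sup>2"
          by (intro tendsto_add tendsto_diff tendsto_mult tendsto_const c n)
        then show ?thesis by simp
      qed
      show "(\<lambda>n. 0 :: real) \<longlonglongrightarrow> 0" by simp
      show "\<forall>\<^sub>F n in sequentially. 0 \<le> 1 / real (Suc n) + 2 * t * (Re (cinner y (x n)) - Re b) + t\<^sup>2 * (norm y)\<^sup>2"
      proof (rule always_eventually, rule allI)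
        fix n
        have "(x n + of_real t *\<^sub>C y, a n + of_real t * b) \<in> G"
          by (intro add scale xa yb)
        from dle[OF this] have "d \<le> (norm (x n))\<^sup>2 + 2 * t * Re (cinner (x n) y) + t\<^sup>2 * (norm y)\<^sup>2
            - 2 * Re (a n) - 2 * t * Re b"
          by (simp add: J_def norm_add_square cinner_scaleC_right norm_scaleC power_mult_distrib)
        then show "0 \<le> 1 / real (Suc n) + 2 * t * (Re (cinner y (x n)) - Re b) + t\<^sup>2 * (norm y)\<^sup>2"
          using q(2)[of n] unfolding Jq by (simp add: algebra_simps cinner_Re_commute[of y])
      qed
    qed simp
    define e where "e = Re (cinner y k) - Re b"
    \<comment> \<open>Adding 1 keeps s positive even for y = 0, so that t = - e / s can be
      inserted.\<close>
    define s where "s = (norm y)\<^sup>2 + 1"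
    have s: "s > 0" by (simp add: s_def add_nonneg_pos)
    have "0 \<le> 2 * (- e / s) * e + (- e / s)\<^sup>2 * (norm y)\<^sup>2"
      using ineq[of "- e / s"] by (simp add: e_def)
    also have "\<dots> \<le> 2 * (- e / s) * e + (- e / s)\<^sup>2 * s"
      by (simp add: s_def mult_left_mono)
    also have "\<dots> = - e\<^sup>2 / s"
      using s by (simp add: power2_eq_square divide_simps)
    finally have "e\<^sup>2 \<le> 0" using s by (simp add: divide_le_0_iff zero_le_divide_iff)
    then show ?thesis by (simp add: e_def)
  qed
  show thesis
  proof (rule that)
    fix y b assume yb: "(y, b) \<in> G"
    \<comment> \<open>The identity of real parts at the multiple of (y, b) by i is the identity of
      imaginary parts at (y, b).\<close>
    have "Re (\<i> * b) = Re (\<i> * cinner y k)"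
      using Re_eq[OF scale[OF yb, of \<i>]] by (simp add: cinner_scaleC_left)
    then show "b = cinner y k" using Re_eq[OF yb] by (simp add: complex_eq_iff)
  qed
qed

section \<open>Resolvents of self-adjoint operators\<close>

lemma linear_op_add: "linear_op S \<Longrightarrow> (f, f') \<in> S \<Longrightarrow> (g, g') \<in> S \<Longrightarrow> (f + g, f' + g') \<in> S"
  and linear_op_scaleC: "linear_op S \<Longrightarrow> (f, f') \<in> S \<Longrightarrow> (c *\<^sub>C f, c *\<^sub>C f') \<in> S"
  and linear_op_zero: "linear_op S \<Longrightarrow> (0, 0) \<in> S"
  and linear_op_unique: "linear_op S \<Longrightarrow> (f, f') \<in> S \<Longrightarrow> (f, f'') \<in> S \<Longrightarrow> f' = f''"
  by (auto simp: linear_op_def dest: single_valuedD)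

lemma linear_op_diff:
  assumes "linear_op S" "(f, f') \<in> S" "(g, g') \<in> S"
  shows "(f - g, f' - g') \<in> S"
  using linear_op_add[OF assms(1,2) linear_op_scaleC[OF assms(1,3), of "-1"]]
  by (simp add: complex_vector.scale_minus_left scaleC_one)

text \<open>Two images of the same vector differ by a vector orthogonal to the dense domain of A, so
  density makes the adjoint relation an operator.\<close>

lemma adjoint_linear_op:
  assumes "closure (Domain A) = UNIV"
  shows "linear_op (adjoint A)"
  unfolding linear_op_def
proof (intro conjI allI impI)
  show "single_valued (adjoint A)"
  proof (rule single_valuedI)
    fix g h k assume "(g, h) \<in> adjoint A" "(g, k) \<in> adjoint A"
    then have "cinner f (h - k) = 0" if "f \<in> Domain A" for f
      using that by (force simp: adjoint_on_def cinner_diff_right)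
    then have "h - k = 0" by (rule dense_orthogonal_eq_zero[OF assms])
    then show "h = k" by simp
  qed
qed (auto simp: adjoint_on_def cinner_algebra)

section \<open>Resolvents of a self-adjoint operator off the real axis\<close>

locale selfadjoint_operator =
  fixes S :: "'h::complex_hilbert graph"
  assumes selfadj: "selfadjoint S"
begin

lemma lin: "linear_op S"
  using selfadj by (simp add: selfadjoint_on_def)

lemma symmetric: "(f, f') \<in> S \<Longrightarrow> (g, g') \<in> S \<Longrightarrow> cinner f' g = cinner f g'"
  using selfadj by (force simp: selfadjoint_on_def adjoint_on_def)

lemma adjointI: "(\<And>f f'. (f, f') \<in> S \<Longrightarrow> cinner f' g = cinner f h) \<Longrightarrow> (g, h) \<in> S"
  using selfadj by (force simp: selfadjoint_on_def adjoint_on_def)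

lemma dense: "closure (Domain S) = UNIV"
  using selfadj by (auto simp: selfadjoint_on_def)

text \<open>Symmetry makes (S f, f) real, so only z contributes to the imaginary part of ((S - z) f,
  f); Cauchy-Schwarz then gives the bound.\<close>

lemma lower_bound:
  assumes "(f, f') \<in> S"
  shows "\<bar>Im z\<bar> * norm f \<le> norm (f' - z *\<^sub>C f)"
proof (cases "f = 0")
  case False
  have "cinner f' f = cnj (cinner f' f)"
    using symmetric[OF assms assms] cinner_commute[of f f'] by simp
  then have "Im (cinner f' f) = 0" by (simp add: complex_eq_iff)
  then have "\<bar>Im z\<bar> * (norm f)\<^sup>2 = \<bar>Im (cinner (f' - z *\<^sub>C f) f)\<bar>"
    by (simp add: cinner_algebra cinner_self abs_mult del: of_real_power)
  also have "\<dots> \<le> cmod (cinner (f' - z *\<^sub>C f) f)" by (rule abs_Im_le_cmod)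
  also have "\<dots> \<le> norm (f' - z *\<^sub>C f) * norm f" by (rule cinner_Cauchy_Schwarz)
  finally have "(\<bar>Im z\<bar> * norm f) * norm f \<le> norm (f' - z *\<^sub>C f) * norm f"
    by (simp add: power2_eq_square mult.assoc)
  then show ?thesis using False by simp
qed simp

text \<open>A weak solution of \<open>(S - z) f = h\<close> comes from the Riesz theorem on the range of \<open>S - cnj z\<close>;
  self-adjointness says that weak solutions are solutions.\<close>

lemma resolvent_exists:
  assumes z: "Im z \<noteq> 0"
  shows "\<exists>f. (f, h + z *\<^sub>C f) \<in> S"
proof -
  define G where "G = {(u' - cnj z *\<^sub>C u, cinner u h) | u u'. (u, u') \<in> S}"
  obtain k where k: "\<And>x a. (x, a) \<in> G \<Longrightarrow> a = cinner x k"
  proof (rule Riesz_representation_graph[of G "norm h / \<bar>Im z\<bar>"])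
    show "(0, 0) \<in> G"
      unfolding G_def using linear_op_zero[OF lin]
      by (auto intro!: exI[of _ 0])
    show "(x + y, a + b) \<in> G" if xa: "(x, a) \<in> G" and yb: "(y, b) \<in> G" for x a y b
    proof -
      obtain u u' v v' where u: "(u, u') \<in> S" "x = u' - cnj z *\<^sub>C u" "a = cinner u h"
        and v: "(v, v') \<in> S" "y = v' - cnj z *\<^sub>C v" "b = cinner v h"
        using xa yb unfolding G_def by blast
      have "x + y = (u' + v') - cnj z *\<^sub>C (u + v)" "a + b = cinner (u + v) h"
        using u v by (simp_all add: cinner_algebra scaleC_add_right)
      then show ?thesis
        unfolding G_def using linear_op_add[OF lin u(1) v(1)] by blast
    qed
    show "(c *\<^sub>C x, c * a) \<in> G" if xa: "(x, a) \<in> G" for c x a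
    proof -
      obtain u u' where u: "(u, u') \<in> S" "x = u' - cnj z *\<^sub>C u" "a = cinner u h"
        using xa unfolding G_def by blast
      have "c *\<^sub>C x = c *\<^sub>C u' - cnj z *\<^sub>C (c *\<^sub>C u)" "c * a = cinner (c *\<^sub>C u) h"
        using u by (simp_all add: cinner_algebra complex_vector.scale_right_diff_distrib
            scaleC_scaleC mult.commute)
      then show ?thesis
        unfolding G_def using linear_op_scaleC[OF lin u(1), of c] by blast
    qed
    show "cmod a \<le> norm h / \<bar>Im z\<bar> * norm x" if xa: "(x, a) \<in> G" for x a
    proof -
      obtain u u' where u: "(u, u') \<in> S" "x = u' - cnj z *\<^sub>C u" "a = cinner u h"
        using xa unfolding G_def by blast
      have "cmod a \<le> norm u * norm h" unfolding u(3) by (rule cinner_Cauchy_Schwarz)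
      also have "\<dots> \<le> (norm x / \<bar>Im z\<bar>) * norm h"
        using lower_bound[OF u(1), of "cnj z"] z u(2)
        by (intro mult_right_mono) (auto simp: field_simps)
      finally show ?thesis by (simp add: mult.commute)
    qed
  qed blast
  have "(k, h + z *\<^sub>C k) \<in> S"
  proof (rule adjointI)
    fix f f' assume "(f, f') \<in> S"
    then have "cinner f h = cinner (f' - cnj z *\<^sub>C f) k"
      by (intro k) (auto simp: G_def)
    then show "cinner f' k = cinner f (h + z *\<^sub>C k)"
      by (simp add: cinner_algebra)
  qed
  then show ?thesis by blast
qed

text \<open>The resolvent (S - z)^{-1} applied to h. Off the real axis a solution exists by
  \<open>resolvent_exists\<close> and the choice is unique by \<open>res_unique\<close>.\<close>

definition res :: "complex \<Rightarrow> 'h \<Rightarrow> 'h" where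
  "res z h = (SOME f. (f, h + z *\<^sub>C f) \<in> S)"

lemma res_in: "Im z \<noteq> 0 \<Longrightarrow> (res z h, h + z *\<^sub>C res z h) \<in> S"
  unfolding res_def by (rule someI_ex) (rule resolvent_exists)

lemma res_norm: "Im z \<noteq> 0 \<Longrightarrow> norm (res z h) \<le> norm h / \<bar>Im z\<bar>"
  using lower_bound[OF res_in, of z z h] by (simp add: field_simps)

lemma eigenvector_eq_zero: "(f, z *\<^sub>C f) \<in> S \<Longrightarrow> Im z \<noteq> 0 \<Longrightarrow> f = 0"
  using lower_bound[of f "z *\<^sub>C f" z] by (simp add: mult_le_0_iff)

lemma res_unique:
  assumes z: "Im z \<noteq> 0" and f: "(f, f') \<in> S" and h: "h = f' - z *\<^sub>C f"
  shows "res z h = f"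
proof -
  have "(res z h - f, (h + z *\<^sub>C res z h) - f') \<in> S"
    by (intro linear_op_diff lin res_in z f)
  moreover have "(h + z *\<^sub>C res z h) - f' = z *\<^sub>C (res z h - f)"
    by (simp add: h complex_vector.scale_right_diff_distrib)
  ultimately have "res z h - f = 0"
    using eigenvector_eq_zero z by metis
  then show ?thesis by simp
qed

lemma res_diff: "Im z \<noteq> 0 \<Longrightarrow> res z (h - k) = res z h - res z k"
  by (rule res_unique[OF _ linear_op_diff[OF lin res_in res_in]])
    (simp_all add: complex_vector.scale_right_diff_distrib)

lemma res_scaleC: "Im z \<noteq> 0 \<Longrightarrow> res z (c *\<^sub>C h) = c *\<^sub>C res z h"
  by (rule res_unique[OF _ linear_op_scaleC[OF lin res_in]])
    (simp_all add: scaleC_add_right scaleC_scaleC mult.commute)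

text \<open>Applying S - z to the left-hand side leaves
  \<open>(z - w) *\<^sub>C res w h\<close>.\<close>

lemma resolvent_identity:
  assumes "Im z \<noteq> 0" "Im w \<noteq> 0"
  shows "res z h - res w h = (z - w) *\<^sub>C res z (res w h)"
proof -
  have "res z ((z - w) *\<^sub>C res w h) = res z h - res w h"
    by (rule res_unique[OF assms(1) linear_op_diff[OF lin res_in res_in]])
      (use assms in \<open>simp_all add: complex_vector.scale_right_diff_distrib complex_vector.scale_left_diff_distrib\<close>)
  then show ?thesis by (simp add: res_scaleC assms)
qed

lemma res_tendsto:
  assumes w: "Im w > 0"
  shows "((\<lambda>z. res z h) \<longlongrightarrow> res w h) (at w)"
proof -
  have op: "open {z. Im z > 0}" by (rule open_halfspace_Im_gt)
  have "((\<lambda>z. cmod (z - w) * (norm h / Im w) / Im z) \<longlongrightarrow> cmod (w - w) * (norm h / Im w) / Im w) (at w)"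
    using w by (intro tendsto_intros) auto
  then have 0: "((\<lambda>z. cmod (z - w) * (norm h / Im w) / Im z) \<longlongrightarrow> 0) (at w)" by simp
  have "\<forall>\<^sub>F z in at w. norm (res z h - res w h) \<le> cmod (z - w) * (norm h / Im w) / Im z"
  proof (rule eventually_mono[OF eventually_at_in_open'[OF op]])
    show "w \<in> {z. Im z > 0}" using w by simp
    fix z assume "z \<in> {z. Im z > 0}"
    then have z: "Im z > 0" by simp
    have "norm (res z h - res w h) = cmod (z - w) * norm (res z (res w h))"
      using z w by (simp add: resolvent_identity norm_scaleC)
    also have "\<dots> \<le> cmod (z - w) * (norm (res w h) / Im z)"
      using res_norm[of z "res w h"] z by (intro mult_left_mono) auto
    also have "\<dots> \<le> cmod (z - w) * ((norm h / Im w) / Im z)"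
      using res_norm[of w h] z w by (intro mult_left_mono divide_right_mono) auto
    finally show "norm (res z h - res w h) \<le> cmod (z - w) * (norm h / Im w) / Im z" by simp
  qed
  then have "((\<lambda>z. res z h - res w h) \<longlongrightarrow> 0) (at w)"
    using 0 by (rule Lim_null_comparison)
  then show ?thesis by (rule LIM_zero_cancel)
qed

text \<open>By the resolvent identity the difference quotient at w is the matrix element of
  \<open>res z (res w h)\<close>, which converges by continuity of the resolvent in z.\<close>

lemma res_holomorphic: "(\<lambda>z. cinner (res z h) g) holomorphic_on {z. Im z > 0}"
proof (rule holomorphic_onI)
  fix w assume "w \<in> {z. Im z > 0}"
  then have w: "Im w > 0" by simp
  have op: "open {z. Im z > 0}" by (rule open_halfspace_Im_gt)
  have "((\<lambda>z. cinner (res z (res w h)) g) \<longlongrightarrow> cinner (res w (res w h)) g) (at w)"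
    by (intro tendsto_cinner_left res_tendsto w)
  moreover have "\<forall>\<^sub>F z in at w. cinner (res z (res w h)) g = (cinner (res z h) g - cinner (res w h) g) / (z - w)"
  proof (rule eventually_mono[OF eventually_at_in_open[OF op]])
    show "w \<in> {z. Im z > 0}" using w by simp
    fix z assume "z \<in> {z. Im z > 0} - {w}"
    then have z: "0 < Im z \<and> z \<noteq> w" by simp
    then show "cinner (res z (res w h)) g = (cinner (res z h) g - cinner (res w h) g) / (z - w)"
      using w by (simp add: cinner_diff_left[symmetric] resolvent_identity cinner_scaleC_left)
  qed
  ultimately have "((\<lambda>z. (cinner (res z h) g - cinner (res w h) g) / (z - w)) \<longlongrightarrow> cinner (res w (res w h)) g) (at w)"
    by (rule Lim_transform_eventually)
  then have "((\<lambda>z. cinner (res z h) g) has_field_derivative cinner (res w (res w h)) g) (at w)"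
    by (simp add: has_field_derivative_iff)
  then show "(\<lambda>z. cinner (res z h) g) field_differentiable at w within {z. Im z > 0}"
    using field_differentiable_def field_differentiable_at_within by blast
qed

text \<open>\<open>h + iy res (iy) h\<close> is \<open>S res (iy) h\<close>, which equals \<open>res (iy) (S h)\<close> on the dense domain of \<open>S\<close>.\<close>

lemma res_imaginary_axis_tendsto:
  "((\<lambda>y. h + (\<i> * of_real y) *\<^sub>C res (\<i> * of_real y) h) \<longlongrightarrow> 0) at_top"
proof (rule tendstoI)
  fix e :: real assume e: "e > 0"
  \<comment> \<open>The error h - k will be counted twice, which uses up e / 2; the other half is
    left for \<open>norm k' / y\<close>.\<close>
  have "\<exists>k\<in>Domain S. dist k h < e / 4"
    using dense e closure_approachable[THEN iffD1, rule_format, of h "Domain S" "e / 4"] by simp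
  then obtain k k' where k: "(k, k') \<in> S" and kh: "norm (k - h) < e / 4"
    by (auto simp: dist_norm)
  show "\<forall>\<^sub>F y in at_top. dist (h + (\<i> * of_real y) *\<^sub>C res (\<i> * of_real y) h) 0 < e"
    using eventually_gt_at_top[of "max 0 (norm k' * 2 / e)"]
  proof eventually_elim
    fix y :: real assume "max 0 (norm k' * 2 / e) < y"
    then have y: "y > 0" and "norm k' * 2 / e < y" by simp_all
    then have k'y: "norm k' / y < e / 2" using e by (simp add: field_simps)
    let ?z = "\<i> * complex_of_real y"
    have z: "Im ?z \<noteq> 0" using y by simp
    have "res ?z (k' - ?z *\<^sub>C k) = k"
      by (rule res_unique[OF z k refl])
    then have "res ?z k' = k + ?z *\<^sub>C res ?z k"
      using z by (simp add: res_diff res_scaleC algebra_simps)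
    then have "h + ?z *\<^sub>C res ?z h = (h - k) + ?z *\<^sub>C res ?z (h - k) + res ?z k'"
      using z by (simp add: res_diff complex_vector.scale_right_diff_distrib)
    also have "norm \<dots> \<le> norm (h - k) + norm (?z *\<^sub>C res ?z (h - k)) + norm (res ?z k')"
      by (intro order_trans[OF norm_triangle_ineq] add_right_mono norm_triangle_ineq)
    also have "\<dots> \<le> norm (h - k) + norm (h - k) + norm k' / y"
    proof (intro add_mono order_refl)
      show "norm (?z *\<^sub>C res ?z (h - k)) \<le> norm (h - k)"
        using res_norm[OF z, of "h - k"] y by (simp add: norm_scaleC norm_mult field_simps)
      show "norm (res ?z k') \<le> norm k' / y" using res_norm[OF z, of k'] y by simp
    qed
    also have "\<dots> < e" using kh k'y norm_minus_commute[of h k] by argo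
    finally show "dist (h + ?z *\<^sub>C res ?z h) 0 < e" by simp
  qed
qed

text \<open>Boundedness of f -> (S f, g) yields a Riesz vector k with (S f, g) = (f, k). This puts g
  into the domain of the adjoint of S, which is S itself.\<close>

lemma bounded_imp_Domain:
  assumes "\<And>f f'. (f, f') \<in> S \<Longrightarrow> cmod (cinner f' g) \<le> C * norm f"
  shows "g \<in> Domain S"
proof -
  define G where "G = {(f, cinner f' g) | f f'. (f, f') \<in> S}"
  obtain k where k: "\<And>x a. (x, a) \<in> G \<Longrightarrow> a = cinner x k"
  proof (rule Riesz_representation_graph[of G C])
    show "(0, 0) \<in> G" unfolding G_def using linear_op_zero[OF lin] by force
    show "(x + y, a + b) \<in> G" if "(x, a) \<in> G" "(y, b) \<in> G" for x a y b
      using that unfolding G_def by (auto simp: cinner_add_left[symmetric] intro: linear_op_add[OF lin])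
    show "(c *\<^sub>C x, c * a) \<in> G" if "(x, a) \<in> G" for c x a
      using that unfolding G_def by (auto simp: cinner_scaleC_left[symmetric] intro: linear_op_scaleC[OF lin])
  qed (auto simp: G_def assms)
  have "(g, k) \<in> S"
  proof (rule adjointI)
    fix f f' assume "(f, f') \<in> S"
    then show "cinner f' g = cinner f k" by (intro k) (auto simp: G_def)
  qed
  then show ?thesis by blast
qed

end

section \<open>The Weyl function of a boundary pair\<close>

text \<open>A boundary triple with scalar boundary values l and p: \<open>green\<close> is the
  abstract Green identity, and S is the self-adjoint extension given by the boundary condition p =
  0.\<close>

locale boundary_pair = selfadjoint_operator S for S :: "'h::complex_hilbert graph" +
  fixes A :: "'h graph" and l p :: "'h \<Rightarrow> complex" and g :: 'h
  assumes denseA: "closure (Domain A) = UNIV"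
    and S_adjoint: "S \<subseteq> adjoint A"
    and green: "\<And>f f' h h'. (f, f') \<in> adjoint A \<Longrightarrow> (h, h') \<in> adjoint A \<Longrightarrow>
       cinner f' h - cinner f h' = l f * cnj (p h) - p f * cnj (l h)"
    and p_add: "\<And>f h. f \<in> H_plus A \<Longrightarrow> h \<in> H_plus A \<Longrightarrow> p (f + h) = p f + p h"
    and p_scaleC: "\<And>c f. f \<in> H_plus A \<Longrightarrow> p (c *\<^sub>C f) = c * p f"
    and l_add: "\<And>f h. f \<in> H_plus A \<Longrightarrow> h \<in> H_plus A \<Longrightarrow> l (f + h) = l f + l h"
    and l_scaleC: "\<And>c f. f \<in> H_plus A \<Longrightarrow> l (c *\<^sub>C f) = c * l f"
    and p_kernel: "\<And>f. f \<in> Domain S \<longleftrightarrow> f \<in> H_plus A \<and> p f = 0"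
    and g: "g \<in> deficiency_space A \<i>" "norm g = 1"
begin

lemma lin_adjoint: "linear_op (adjoint A)"
  by (rule adjoint_linear_op[OF denseA])

lemma g_adjoint: "(g, \<i> *\<^sub>C g) \<in> adjoint A"
  using g by (simp add: deficiency_space_def)

text \<open>Otherwise g would be an eigenvector of the self-adjoint S for the eigenvalue i.\<close>

lemma pg_nonzero: "p g \<noteq> 0"
proof
  assume "p g = 0"
  then have "g \<in> Domain S"
    using g_adjoint by (auto simp: p_kernel H_plus_def)
  then obtain g' where "(g, g') \<in> S" by blast
  moreover from this have "g' = \<i> *\<^sub>C g"
    using S_adjoint linear_op_unique[OF lin_adjoint _ g_adjoint] by blast
  ultimately have "g = 0" using eigenvector_eq_zero[of g \<i>] by simp
  then show False using g by simp
qed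

text \<open>This is (S - i) (S - z)^{-1} g, the standard transport of a deficiency vector from i to
  z. It differs from g by an element of Dom S, so p keeps its value.\<close>

definition defect :: "complex \<Rightarrow> 'h" where
  "defect z = g + (z - \<i>) *\<^sub>C res z g"

lemma defect_adjoint:
  assumes "Im z \<noteq> 0"
  shows "(defect z, z *\<^sub>C defect z) \<in> adjoint A"
proof -
  have "(defect z, \<i> *\<^sub>C g + (z - \<i>) *\<^sub>C (g + z *\<^sub>C res z g)) \<in> adjoint A"
    unfolding defect_def
    by (intro linear_op_add[OF lin_adjoint] linear_op_scaleC[OF lin_adjoint] g_adjoint)
      (use res_in[OF assms] S_adjoint in blast)
  moreover have "\<i> *\<^sub>C g + (z - \<i>) *\<^sub>C (g + z *\<^sub>C res z g) = z *\<^sub>C defect z"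
    by (simp add: defect_def scaleC_add_right scaleC_scaleC complex_vector.scale_left_diff_distrib
        complex_vector.scale_right_diff_distrib right_diff_distrib left_diff_distrib mult.commute)
  ultimately show ?thesis by simp
qed

lemma res_H_plus: "Im z \<noteq> 0 \<Longrightarrow> res z h \<in> H_plus A"
  using res_in[of z h] p_kernel by blast

lemma p_defect: "Im z \<noteq> 0 \<Longrightarrow> p (defect z) = p g"
proof -
  assume z: "Im z \<noteq> 0"
  have "g \<in> H_plus A" using g_adjoint by (auto simp: H_plus_def)
  moreover have "(z - \<i>) *\<^sub>C res z g \<in> H_plus A"
    using linear_op_scaleC[OF lin res_in[OF z]] p_kernel by blast
  moreover have "p (res z g) = 0" using res_in[OF z] p_kernel by blast
  ultimately show ?thesis
    using z by (simp add: defect_def p_add p_scaleC res_H_plus)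
qed

text \<open>The quotient l f / p f at f = \<open>defect z\<close>; by \<open>p_defect\<close> the
  denominator is \<open>p g\<close> for every nonreal z.\<close>

definition weyl :: "complex \<Rightarrow> complex" where
  "weyl z = l (defect z) / p g"

lemma defect_i: "defect \<i> = g"
  by (simp add: defect_def)

text \<open>Green's identity with \<open>defect z\<close> in both places.\<close>

lemma Im_weyl:
  assumes "Im z \<noteq> 0"
  shows "Im (weyl z) = Im z * (norm (defect z))\<^sup>2 / (cmod (p g))\<^sup>2"
proof -
  have "cinner (z *\<^sub>C defect z) (defect z) - cinner (defect z) (z *\<^sub>C defect z) =
      l (defect z) * cnj (p g) - p g * cnj (l (defect z))"
    using green[OF defect_adjoint[OF assms] defect_adjoint[OF assms]] assms by (simp add: p_defect)
  also have "l (defect z) = weyl z * p g"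
    using pg_nonzero by (simp add: weyl_def)
  also have "cinner (z *\<^sub>C defect z) (defect z) - cinner (defect z) (z *\<^sub>C defect z) =
     (z - cnj z) * (norm (defect z))\<^sup>2"
    by (simp add: cinner_algebra cinner_self left_diff_distrib)
  also have "weyl z * p g * cnj (p g) - p g * cnj (weyl z * p g) = (weyl z - cnj (weyl z)) * (cmod (p g))\<^sup>2"
    by (simp only: complex_norm_square complex_cnj_mult) (simp add: algebra_simps)
  finally have "2 * Im z * (norm (defect z))\<^sup>2 = 2 * Im (weyl z) * (cmod (p g))\<^sup>2"
    unfolding complex_diff_cnj by (simp add: complex_eq_iff del: of_real_power)
  then show ?thesis using pg_nonzero by (simp add: field_simps)
qed

text \<open>Green's identity for \<open>defect z\<close> against g. It expresses the dependence on z
  through one matrix element of the resolvent, from which analyticity follows.\<close>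

lemma weyl_formula:
  assumes "Im z \<noteq> 0"
  shows "weyl z = cnj (weyl \<i>) + (z + \<i>) * (1 + (z - \<i>) * cinner (res z g) g) / (cmod (p g))\<^sup>2"
proof -
  have cc: "complex_of_real ((cmod (p g))\<^sup>2) = p g * cnj (p g)"
    by (rule complex_norm_square)
  have "cinner (z *\<^sub>C defect z) g - cinner (defect z) (\<i> *\<^sub>C g) =
      l (defect z) * cnj (p g) - p g * cnj (l g)"
    using green[OF defect_adjoint[OF assms] g_adjoint] assms by (simp add: p_defect)
  moreover have "cinner (z *\<^sub>C defect z) g - cinner (defect z) (\<i> *\<^sub>C g) = (z + \<i>) * cinner (defect z) g"
    by (simp add: cinner_algebra left_diff_distrib distrib_right)
  moreover have "cinner (defect z) g = 1 + (z - \<i>) * cinner (res z g) g"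
    using g by (simp add: defect_def cinner_algebra cinner_self)
  ultimately have "(z + \<i>) * (1 + (z - \<i>) * cinner (res z g) g) = l (defect z) * cnj (p g) - p g * cnj (l g)"
    by simp
  then show ?thesis
    using pg_nonzero unfolding cc weyl_def defect_i by (simp add: divide_simps)
qed

lemma weyl_holomorphic: "weyl holomorphic_on {z. Im z > 0}"
proof -
  have "(\<lambda>z. cnj (weyl \<i>) + (z + \<i>) * (1 + (z - \<i>) * cinner (res z g) g) / (cmod (p g))\<^sup>2)
      holomorphic_on {z. Im z > 0}"
    using pg_nonzero by (intro holomorphic_intros res_holomorphic) auto
  then show ?thesis
    by (rule holomorphic_transform) (rule weyl_formula[symmetric], simp)
qed

section \<open>Positivity of the Weyl function and its growth along the imaginary axis\<close>

lemma Im_weyl_pos: "Im z > 0 \<Longrightarrow> Im (weyl z) > 0"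
proof -
  assume z: "Im z > 0"
  have "p 0 = 0" using p_kernel[of 0] linear_op_zero[OF lin] by blast
  then have "defect z \<noteq> 0" using p_defect[of z] z pg_nonzero by auto
  then show ?thesis using z pg_nonzero by (simp add: Im_weyl)
qed

text \<open>At z = iy the defect vector is S (S - z)^{-1} g - i (S - z)^{-1} g. The first term tends
  to 0 by \<open>res_imaginary_axis_tendsto\<close>, the second has norm at most 1 / y.\<close>

lemma defect_tendsto: "((\<lambda>y. norm (defect (\<i> * of_real y))) \<longlongrightarrow> 0) at_top"
proof (rule Lim_null_comparison)
  let ?e = "\<lambda>y. g + (\<i> * of_real y) *\<^sub>C res (\<i> * of_real y) g"
  have "((\<lambda>y::real. norm (?e y) + 1 / y) \<longlongrightarrow> 0 + 0) at_top"
    using res_imaginary_axis_tendsto[of g]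
    by (intro tendsto_add tendsto_norm_zero tendsto_divide_0[OF tendsto_const] filterlim_at_top_imp_at_infinity filterlim_ident)
  then show "((\<lambda>y::real. norm (?e y) + 1 / y) \<longlongrightarrow> 0) at_top" by simp
  show "\<forall>\<^sub>F y in at_top. norm (norm (defect (\<i> * of_real y))) \<le> norm (?e y) + 1 / y"
    using eventually_gt_at_top[of 0]
  proof eventually_elim
    fix y :: real assume y: "y > 0"
    have "defect (\<i> * of_real y) = ?e y - \<i> *\<^sub>C res (\<i> * of_real y) g"
      by (simp add: defect_def complex_vector.scale_left_diff_distrib)
    then have "norm (defect (\<i> * of_real y)) \<le> norm (?e y) + norm (\<i> *\<^sub>C res (\<i> * of_real y) g)"
      using norm_triangle_ineq4 by metis
    also have "norm (\<i> *\<^sub>C res (\<i> * of_real y) g) \<le> 1 / y"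
      using res_norm[of "\<i> * of_real y" g] y g by (simp add: norm_scaleC)
    finally show "norm (norm (defect (\<i> * of_real y))) \<le> norm (?e y) + 1 / y" by simp
  qed
qed

lemma weyl_sublinear: "((\<lambda>y. Im (weyl (\<i> * of_real y)) / y) \<longlongrightarrow> 0) at_top"
proof -
  have "((\<lambda>y. (norm (defect (\<i> * of_real y)))\<^sup>2 / (cmod (p g))\<^sup>2) \<longlongrightarrow> 0\<^sup>2 / (cmod (p g))\<^sup>2) at_top"
    using pg_nonzero by (intro tendsto_intros defect_tendsto) auto
  then have "((\<lambda>y. (norm (defect (\<i> * of_real y)))\<^sup>2 / (cmod (p g))\<^sup>2) \<longlongrightarrow> 0) at_top"
    by simp
  moreover have "\<forall>\<^sub>F y in at_top. (norm (defect (\<i> * of_real y)))\<^sup>2 / (cmod (p g))\<^sup>2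
      = Im (weyl (\<i> * of_real y)) / y"
    using eventually_gt_at_top[of 0] by eventually_elim (simp add: Im_weyl)
  ultimately show ?thesis by (rule Lim_transform_eventually)
qed

text \<open>Otherwise \<open>y *\<^sub>R defect (iy)\<close>, which up to a bounded term is \<open>S\<close> applied to
  \<open>y *\<^sub>R res (iy) g \<longrightarrow> i g\<close>, would stay bounded, and \<open>g\<close> would belong to the domain of \<open>S\<close>.\<close>

lemma weyl_unbounded: "\<exists>y>0. y * Im (weyl (\<i> * of_real y)) > C"
proof (rule ccontr)
  assume "\<not> ?thesis"
  then have "y * Im (weyl (\<i> * of_real y)) \<le> C" if "y > 0" for y
    using that by force
  then have "(y * norm (defect (\<i> * of_real y)))\<^sup>2 \<le> C * (cmod (p g))\<^sup>2" if "y > 0" for y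
    using that pg_nonzero by (force simp: Im_weyl power2_eq_square field_simps)
  then have bound: "y * norm (defect (\<i> * of_real y)) \<le> sqrt (C * (cmod (p g))\<^sup>2)" if "y > 0" for y
    using that by (simp add: real_le_rsqrt)
  \<comment> \<open>The extra 1 absorbs y times the norm of the resolvent vector, which is at most
    1.\<close>
  define D where "D = sqrt (C * (cmod (p g))\<^sup>2) + 1"
  have "g \<in> Domain S"
  proof (rule bounded_imp_Domain)
    fix f f' assume f: "(f, f') \<in> S"
    let ?r = "\<lambda>y. (of_real y) *\<^sub>C res (\<i> * of_real y) g"
    have "((\<lambda>y. cinner f' (g + (\<i> * of_real y) *\<^sub>C res (\<i> * of_real y) g)) \<longlongrightarrow> cinner f' 0) at_top"
      by (intro tendsto_cinner_right res_imaginary_axis_tendsto)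
    then have "((\<lambda>y. - \<i> * (cinner f' (g + (\<i> * of_real y) *\<^sub>C res (\<i> * of_real y) g) - cinner f' g)) \<longlongrightarrow> - \<i> * (cinner f' 0 - cinner f' g)) at_top"
      by (intro tendsto_intros)
    then have "((\<lambda>y. - cinner f' (?r y)) \<longlongrightarrow> \<i> * cinner f' g) at_top"
      by (simp add: cinner_algebra mult.assoc[symmetric])
    then have lim: "((\<lambda>y. cmod (- cinner f' (?r y))) \<longlongrightarrow> cmod (\<i> * cinner f' g)) at_top"
      by (rule tendsto_norm)
    have "cmod (\<i> * cinner f' g) \<le> D * norm f"
    proof (rule tendsto_upperbound[OF lim])
      show "\<forall>\<^sub>F y in at_top. cmod (- cinner f' (?r y)) \<le> D * norm f"
        using eventually_gt_at_top[of 0]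
      proof eventually_elim
        fix y :: real assume y: "y > 0"
        let ?z = "\<i> * complex_of_real y"
        have z: "Im ?z \<noteq> 0" using y by simp
        have "g + ?z *\<^sub>C res ?z g = defect ?z + \<i> *\<^sub>C res ?z g"
          by (simp add: defect_def complex_vector.scale_left_diff_distrib)
        then have "(?r y, (of_real y) *\<^sub>C (defect ?z + \<i> *\<^sub>C res ?z g)) \<in> S"
          using linear_op_scaleC[OF lin res_in[OF z, of g]] by metis
        from symmetric[OF f this] have "cmod (cinner f' (?r y)) = cmod (cinner f ((of_real y) *\<^sub>C (defect ?z + \<i> *\<^sub>C res ?z g)))"
          by simp
        also have "\<dots> \<le> norm f * norm ((of_real y) *\<^sub>C (defect ?z + \<i> *\<^sub>C res ?z g))"
          by (rule cinner_Cauchy_Schwarz)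
        also have "norm ((of_real y) *\<^sub>C (defect ?z + \<i> *\<^sub>C res ?z g)) = y * norm (defect ?z + \<i> *\<^sub>C res ?z g)"
          using y by (simp add: norm_scaleC)
        also have "\<dots> \<le> y * (norm (defect ?z) + norm (\<i> *\<^sub>C res ?z g))"
          using y by (intro mult_left_mono norm_triangle_ineq) auto
        also have "norm (\<i> *\<^sub>C res ?z g) \<le> 1 / y"
          using res_norm[OF z, of g] y g by (simp add: norm_scaleC)
        also have "y * (norm (defect ?z) + 1 / y) \<le> D"
          using bound[OF y] y by (simp add: D_def distrib_left)
        finally show "cmod (- cinner f' (?r y)) \<le> D * norm f"
          using y by (simp add: mult.commute mult_left_mono mult_right_mono)
      qed
    qed simp
    then show "cmod (cinner f' g) \<le> D * norm f" by (simp add: norm_mult)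
  qed
  then show False using p_kernel pg_nonzero by blast
qed

text \<open>Between ker (\<open>adjoint A\<close> - i) and ker (\<open>adjoint A\<close> + i) the
  left-hand side of Green's identity vanishes, so the ratios l / p of g and h are conjugate to each
  other.\<close>

lemma l_eq_cnj_weyl:
  assumes "h \<in> deficiency_space A (- \<i>)"
  shows "l h = cnj (weyl \<i>) * p h"
proof -
  have h: "(h, (- \<i>) *\<^sub>C h) \<in> adjoint A" using assms by (simp add: deficiency_space_def)
  have "l g * cnj (p h) = p g * cnj (l h)"
    using green[OF g_adjoint h] by (simp add: cinner_algebra)
  then have "cnj (l g * cnj (p h)) = cnj (p g * cnj (l h))" by simp
  then show ?thesis using pg_nonzero by (simp add: weyl_def defect_i field_simps)
qed

end

section \<open>L-systems\<close>

lemma deficiency_dim_1: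
  assumes "complex_vector.dim (deficiency_space A z) = 1" "g \<in> deficiency_space A z" "g \<noteq> 0"
    and "f \<in> deficiency_space A z"
  shows "\<exists>c. f = c *\<^sub>C g"
proof -
  let ?N = "deficiency_space A z"
  have sub: "complex_vector.subspace ?N"
    unfolding complex_vector.subspace_def deficiency_space_def adjoint_on_def
    by (auto simp: cinner_algebra scaleC_add_right scaleC_scaleC mult.left_commute distrib_left)
  obtain b where b: "b \<subseteq> ?N" "complex_vector.independent b" "?N \<subseteq> complex_vector.span b" "card b = 1"
    using complex_vector.basis_exists[of ?N] assms(1) by metis
  obtain e where e: "b = {e}" using b(4) by (auto simp: card_1_singleton_iff)
  have sp: "\<exists>c. x = c *\<^sub>C e" if "x \<in> ?N" for x
    using b(3) that by (auto simp: e complex_vector.span_singleton)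
  obtain c d where c: "g = c *\<^sub>C e" and d: "f = d *\<^sub>C e" using sp assms by blast
  have "c \<noteq> 0" using c assms(3) by auto
  then have "f = (d / c) *\<^sub>C g" by (simp add: c d scaleC_scaleC)
  then show ?thesis by blast
qed

text \<open>The first argument is the image of the second under \<open>adjoint A\<close> when gp and
  gm are deficiency vectors at i and -i. The cross terms add up to a real number. The result
  provides a vector on which the quadratic form of T is not real.\<close>

lemma Im_cinner_main_vector:
  assumes "norm gp = 1" "norm (gm :: 'h::complex_hilbert) = 1"
  shows "Im (cinner (\<i> *\<^sub>C gp + (\<i> * of_real \<kappa>) *\<^sub>C gm) (gp - of_real \<kappa> *\<^sub>C gm)) = 1 - \<kappa>\<^sup>2"
  using assms cinner_commute[of gm gp]
  by (simp add: cinner_algebra cinner_self power2_eq_square algebra_simps)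

text \<open>The difference of Re B and \<open>adjoint A\<close> is a form Q that vanishes on Dom S,
  and H_+ is Dom S plus the span of g, so Q has rank one. On Dom T the form is known from Im B and
  involves only l; since \<open>l t\<close> is nonzero, the second factor of Q is l everywhere, and
  p is the first factor.\<close>

lemma L_system_boundary_pair:
  fixes A T :: "'h::complex_hilbert graph"
  assumes L: "L_system A T B K"
    and t: "(t, t') \<in> T" "Im (cinner t' t) \<noteq> 0"
    and g: "g \<in> deficiency_space A \<i>" "norm g = 1"
  obtains p where "boundary_pair (quasi_kernel A (rigged_Re A B)) A (channel_adjoint K) p g"
    "\<And>f. f \<in> Domain T \<Longrightarrow> p f = - \<i> * channel_adjoint K f"
    "\<And>z. Im z > 0 \<Longrightarrow> impedance A B K z =
       boundary_pair.weyl (quasi_kernel A (rigged_Re A B)) (channel_adjoint K) p g z"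
proof -
  have A: "closure (Domain A) = UNIV" "symmetric_op A"
    and dim1: "complex_vector.dim (deficiency_space A \<i>) = 1"
    and T: "T \<subseteq> adjoint A"
    and bd: "bounded_rigged_op A B"
    and AT: "A \<subseteq> T" and BT: "rigged_extends A B T"
    and sa: "selfadjoint (quasi_kernel A (rigged_Re A B))"
    and ch: "bounded_channel A K"
    and Im_B: "\<And>f. f \<in> H_plus A \<Longrightarrow> rigged_Im A B f = K (channel_adjoint K f)"
    using L unfolding L_system_def closed_densely_defined_symmetric_def deficiency_indices_1_1_def
      class_Lambda_def star_extension_def by auto
  define H where "H = H_plus A"
  define S where "S = quasi_kernel A (rigged_Re A B)"
  define R where "R = rigged_Re A B"
  define l where "l = channel_adjoint K"
  define As where "As = app (adjoint A)"
  have lin: "linear_op (adjoint A)" by (rule adjoint_linear_op[OF A(1)])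
  have appI: "As f = f'" if "(f, f') \<in> adjoint A" for f f'
    unfolding As_def app_def using that linear_op_unique[OF lin] by blast
  have As: "(f, As f) \<in> adjoint A" if "f \<in> H" for f
    using that appI unfolding H_def H_plus_def by blast
  have HI: "f \<in> H" if "(f, f') \<in> adjoint A" for f f'
    using that unfolding H_def H_plus_def by blast
  have H_add: "f + h \<in> H" if "f \<in> H" "h \<in> H" for f h
    using HI[OF linear_op_add[OF lin As As]] that by blast
  have H_scale: "c *\<^sub>C f \<in> H" if "f \<in> H" for c f
    using HI[OF linear_op_scaleC[OF lin As]] that by blast
  have As_add: "As (f + h) = As f + As h" if "f \<in> H" "h \<in> H" for f h
    using appI[OF linear_op_add[OF lin As As]] that by blast
  have As_scale: "As (c *\<^sub>C f) = c *\<^sub>C As f" if "f \<in> H" for c f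
    using appI[OF linear_op_scaleC[OF lin As]] that by blast
  have A_sub: "A \<subseteq> adjoint A" using AT T by blast
  have B_minus: "B f \<in> H_minus A" if "f \<in> H" for f
    using bd that unfolding bounded_rigged_op_def H_def by blast
  have B_add: "B (f + h) k = B f k + B h k" if "f \<in> H" "h \<in> H" for f h k
    using bd that unfolding bounded_rigged_op_def H_def by metis
  have B_scale: "B (c *\<^sub>C f) k = c * B f k" if "f \<in> H" for c f k
    using bd that unfolding bounded_rigged_op_def H_def by metis
  have B_add_r: "B k (f + h) = B k f + B k h" if "f \<in> H" "h \<in> H" "k \<in> H" for f h k
    using B_minus[of k] that unfolding H_minus_def H_def by blast
  have B_scale_r: "B k (c *\<^sub>C f) = cnj c * B k f" if "f \<in> H" "k \<in> H" for c f k
    using B_minus[of k] that unfolding H_minus_def H_def by blast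
  have B_out: "B f h = 0" if "f \<in> H" "h \<notin> H" for f h
    using B_minus[of f] that unfolding H_minus_def H_def by blast
  have R: "R f h = (B f h + cnj (B h f)) / 2" if "h \<in> H" for f h
    using that by (simp add: R_def rigged_Re_def rigged_adjoint_def H_def)
  have R_out: "R f h = 0" if "f \<in> H" "h \<notin> H" for f h
    using that B_out by (simp add: R_def rigged_Re_def rigged_adjoint_def H_def)
  have R_add: "R (f + h) k = R f k + R h k" if "f \<in> H" "h \<in> H" "k \<in> H" for f h k
    using that by (simp add: R B_add B_add_r add_divide_distrib)
  have R_scale: "R (c *\<^sub>C f) k = c * R f k" if "f \<in> H" "k \<in> H" for c f k
    using that by (simp add: R B_scale B_scale_r ring_distribs)
  have R_sym: "R f h = cnj (R h f)" if "f \<in> H" "h \<in> H" for f h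
    using that by (simp add: R add.commute)
  have K_scale: "K (c * d) h = c * K d h" for c d h
    using ch unfolding bounded_channel_def by metis
  have K1: "K 1 h = cnj (l h)" for h
    unfolding l_def channel_adjoint_eq[OF ch] by simp
  have Kc: "K c h = c * cnj (l h)" for c h
    using K_scale[of c 1 h] K1 by simp
  have K_minus: "K 1 \<in> H_minus A"
    using ch unfolding bounded_channel_def by blast
  have "K 1 (f + h) = K 1 f + K 1 h" if "f \<in> H" "h \<in> H" for f h
    using K_minus that unfolding H_minus_def H_def by blast
  then have l_add: "l (f + h) = l f + l h" if "f \<in> H" "h \<in> H" for f h
    using that unfolding K1 complex_cnj_add[symmetric] complex_cnj_cancel_iff by blast
  have "K 1 (c *\<^sub>C f) = cnj c * K 1 f" if "f \<in> H" for c f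
    using K_minus that unfolding H_minus_def H_def by blast
  then have l_scale: "l (c *\<^sub>C f) = c * l f" if "f \<in> H" for c f
    using that unfolding K1 complex_cnj_mult[symmetric] complex_cnj_cancel_iff by blast
  have "K 1 h = 0" if "h \<notin> H" for h
    using K_minus that unfolding H_minus_def H_def by blast
  then have l_out: "l h = 0" if "h \<notin> H" for h
    using that unfolding K1 complex_cnj_zero_iff by blast
  have Im_eq: "(B f h - cnj (B h f)) / (2 * \<i>) = l f * cnj (l h)" if "f \<in> H" "h \<in> H" for f h
  proof -
    have "rigged_Im A B f h = K (l f) h"
      using Im_B[of f] that by (simp add: H_def l_def)
    then show ?thesis using that by (simp add: rigged_Im_def rigged_adjoint_def H_def Kc)
  qed
  have B_eq: "B f h = R f h + \<i> * l f * cnj (l h)" if "f \<in> H" "h \<in> H" for f h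
    using Im_eq[OF that] that by (simp add: R field_simps)
  have T_eq: "R f h = cinner f' h - \<i> * l f * cnj (l h)" if "(f, f') \<in> T" "h \<in> H" for f f' h
  proof -
    have "f \<in> H" "B f = embed A f'" using BT that unfolding rigged_extends_def H_def by auto
    then show ?thesis using B_eq[of f h] that by (simp add: embed_def H_def)
  qed
  \<comment> \<open>B agrees with the symmetric A on Dom A, so the quadratic form of Im B vanishes
    there; by \<open>Im_eq\<close> that form is the squared modulus of l.\<close>
  have l_A: "l a = 0" if "(a, a') \<in> A" for a a'
  proof -
    have "a \<in> H" "B a = embed A a'" using BT AT that unfolding rigged_extends_def H_def by auto
    then have "B a a = cinner a' a" by (simp add: embed_def H_def)
    moreover have "cinner a' a = cinner a a'" using A(2) that by (auto simp: symmetric_op_def)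
    then have "cnj (cinner a' a) = cinner a' a" using cinner_commute[of a a'] by simp
    ultimately have "l a * cnj (l a) = 0" using Im_eq[OF \<open>a \<in> H\<close> \<open>a \<in> H\<close>] by simp
    then show ?thesis by simp
  qed
  have R_A: "R f a = cinner f a'" if "(a, a') \<in> A" "f \<in> H" for a a' f
  proof -
    have "a \<in> H" using that A_sub HI by blast
    then have "R f a = cnj (R a f)" using R_sym that by blast
    also have "R a f = cinner a' f" using T_eq[of a a' f] AT that l_A[OF that(1)] by auto
    finally show ?thesis using cinner_commute[of f a'] by simp
  qed
  have S_iff: "(f, f') \<in> S \<longleftrightarrow> f \<in> H \<and> (\<forall>h\<in>H. R f h = cinner f' h)" for f f'
    unfolding S_def quasi_kernel_def using R_out
    by (auto simp: embed_def fun_eq_iff R_def[symmetric] H_def[symmetric])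
  have S_adj: "S \<subseteq> adjoint A"
  proof clarify
    fix f f' assume f: "(f, f') \<in> S"
    have "cinner a' f = cinner a f'" if a: "(a, a') \<in> A" for a a'
    proof -
      have "a \<in> H" using a A_sub HI by blast
      then have "cinner f a' = cinner f' a" using R_A[OF a, of f] f S_iff by metis
      then show ?thesis by (metis cinner_commute)
    qed
    then show "(f, f') \<in> adjoint A" by (simp add: adjoint_on_def)
  qed
  interpret S: selfadjoint_operator S by standard (use sa S_def in simp)
  have gA: "(g, \<i> *\<^sub>C g) \<in> adjoint A" using g by (simp add: deficiency_space_def)
  have gH: "g \<in> H" by (rule HI[OF gA])
  define Q where "Q f h = R f h - cinner (As f) h" for f h
  have Q_add: "Q (f + h) k = Q f k + Q h k" if "f \<in> H" "h \<in> H" "k \<in> H" for f h k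
    using that by (simp add: Q_def R_add As_add cinner_algebra)
  have Q_scale: "Q (c *\<^sub>C f) k = c * Q f k" if "f \<in> H" "k \<in> H" for c f k
    using that by (simp add: Q_def R_scale As_scale cinner_algebra ring_distribs)
  have S_Q: "f \<in> Domain S \<longleftrightarrow> f \<in> H \<and> (\<forall>h\<in>H. Q f h = 0)" for f
  proof
    assume "f \<in> Domain S"
    then obtain f' where f: "(f, f') \<in> S" by blast
    then have "As f = f'" using S_adj appI by blast
    then show "f \<in> H \<and> (\<forall>h\<in>H. Q f h = 0)" using f by (simp add: S_iff Q_def)
  next
    assume "f \<in> H \<and> (\<forall>h\<in>H. Q f h = 0)"
    then have "(f, As f) \<in> S" by (simp add: S_iff Q_def)
    then show "f \<in> Domain S" by blast
  qed
  \<comment> \<open>The vector u = (S - i)^{-1} (\<open>adjoint A\<close> - i) f lies in Dom S,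
    where Q vanishes, and f - u lies in the one-dimensional deficiency space spanned by g.\<close>
  have decomp: "\<exists>c. \<forall>h\<in>H. Q f h = c * Q g h" if f: "f \<in> H" for f
  proof -
    obtain u where u: "(u, (As f - \<i> *\<^sub>C f) + \<i> *\<^sub>C u) \<in> S"
      using S.resolvent_exists[of \<i> "As f - \<i> *\<^sub>C f"] by auto
    have "(f - u, As f - ((As f - \<i> *\<^sub>C f) + \<i> *\<^sub>C u)) \<in> adjoint A"
      by (intro linear_op_diff lin As f) (use u S_adj in blast)
    moreover have "As f - ((As f - \<i> *\<^sub>C f) + \<i> *\<^sub>C u) = \<i> *\<^sub>C (f - u)"
      by (simp add: complex_vector.scale_right_diff_distrib)
    ultimately have "f - u \<in> deficiency_space A \<i>" by (simp add: deficiency_space_def)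
    then obtain c where c: "f - u = c *\<^sub>C g"
      using deficiency_dim_1[OF dim1 g(1)] g(2) by fastforce
    then have fu: "f = u + c *\<^sub>C g" by (simp add: algebra_simps)
    have uS: "u \<in> Domain S" using u by blast
    have "Q f h = c * Q g h" if "h \<in> H" for h
      unfolding fu using uS that gH by (simp add: Q_add H_scale Q_scale S_Q)
    then show ?thesis by blast
  qed
  have tH: "t \<in> H" using t T HI by blast
  have At: "As f = f'" if "(f, f') \<in> T" for f f'
    using that T appI by blast
  have Q_T: "Q f h = - \<i> * l f * cnj (l h)" if "(f, f') \<in> T" "h \<in> H" for f f' h
    using T_eq[OF that] At[OF that(1)] by (simp add: Q_def)
  \<comment> \<open>If l vanished at t, then (T t, t) would equal the value of the hermitian form R
    at t, which is real.\<close>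
  have lt: "l t \<noteq> 0"
  proof
    assume "l t = 0"
    then have "R t t = cinner t' t" using T_eq[OF t(1) tH] by simp
    then have "Im (cinner t' t) = 0" using R_sym[OF tH tH] by (metis complex_cnj_cnj Reals_cnj_iff complex_is_Real_iff)
    then show False using t by simp
  qed
  obtain c0 where c0: "\<And>h. h \<in> H \<Longrightarrow> Q t h = c0 * Q g h" using decomp[OF tH] by blast
  have c0n: "c0 \<noteq> 0" using c0[OF tH] Q_T[OF t(1) tH] lt by auto
  define \<alpha> where "\<alpha> = - \<i> * l t / c0"
  have Qg: "Q g h = \<alpha> * cnj (l h)" if "h \<in> H" for h
    using c0[OF that] Q_T[OF t(1) that] c0n by (simp add: \<alpha>_def field_simps)
  \<comment> \<open>The first factor of the rank-one form is read off by testing against t, where l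
    is nonzero.\<close>
  define p where "p f = Q f t / cnj (l t)" for f
  have Qp: "Q f h = p f * cnj (l h)" if f: "f \<in> H" and h: "h \<in> H" for f h
  proof -
    obtain c where "\<And>h. h \<in> H \<Longrightarrow> Q f h = c * Q g h" using decomp[OF f] by blast
    then have "Q f t = c * \<alpha> * cnj (l t)" "Q f h = c * \<alpha> * cnj (l h)" using Qg tH h by simp_all
    then show ?thesis using lt by (simp add: p_def)
  qed
  have Rp: "R f h = cinner f' h + p f * cnj (l h)" if "(f, f') \<in> adjoint A" "h \<in> H" for f f' h
    using Qp[OF HI[OF that(1)] that(2)] appI[OF that(1)] by (simp add: Q_def algebra_simps)
  have pT: "p f = - \<i> * l f" if "f \<in> Domain T" for f
    using that Q_T tH lt by (auto simp: p_def)
  have bp: "boundary_pair S A l p g"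
  proof
    show "closure (Domain A) = UNIV" by (rule A(1))
    show "S \<subseteq> adjoint A" by (rule S_adj)
    show "cinner f' h - cinner f h' = l f * cnj (p h) - p f * cnj (l h)"
      if f: "(f, f') \<in> adjoint A" and h: "(h, h') \<in> adjoint A" for f f' h h'
    proof -
      \<comment> \<open>Green's identity is the hermitian symmetry of Re B, written out with
        \<open>Rp\<close> on both sides.\<close>
      have "cinner f' h + p f * cnj (l h) = cnj (cinner h' f + p h * cnj (l f))"
        using Rp[OF f HI[OF h]] Rp[OF h HI[OF f]] R_sym[OF HI[OF f] HI[OF h]] by simp
      also have "\<dots> = cinner f h' + cnj (p h) * l f"
        by (simp flip: cinner_commute)
      finally show ?thesis by (simp add: algebra_simps)
    qed
    show "p (f + h) = p f + p h" if "f \<in> H_plus A" "h \<in> H_plus A" for f h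
      using that tH by (simp add: p_def Q_add add_divide_distrib flip: H_def)
    show "p (c *\<^sub>C f) = c * p f" if "f \<in> H_plus A" for c f
      using that tH by (simp add: p_def Q_scale flip: H_def)
    show "l (f + h) = l f + l h" if "f \<in> H_plus A" "h \<in> H_plus A" for f h
      using that by (simp add: l_add flip: H_def)
    show "l (c *\<^sub>C f) = c * l f" if "f \<in> H_plus A" for c f
      using that by (simp add: l_scale flip: H_def)
    show "f \<in> Domain S \<longleftrightarrow> f \<in> H_plus A \<and> p f = 0" for f
    proof -
      have "(\<forall>h\<in>H. Q f h = 0) \<longleftrightarrow> p f = 0" if "f \<in> H"
        using Qp[OF that] lt tH by auto
      then show ?thesis unfolding S_Q H_def[symmetric] by blast
    qed
  qed (rule g)+
  then interpret b: boundary_pair S A l p g .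
  have imp: "impedance A B K z = b.weyl z" if z: "Im z > 0" for z
  proof -
    \<comment> \<open>Scaling the defect vector to p = 1 makes the singular part of Re B f0 exactly
      K 1, while the regular part cancels z f0.\<close>
    define f0 where "f0 = (1 / p g) *\<^sub>C b.defect z"
    have z0: "Im z \<noteq> 0" using z by simp
    have dA: "(b.defect z, z *\<^sub>C b.defect z) \<in> adjoint A" by (rule b.defect_adjoint[OF z0])
    have "(f0, (1 / p g) *\<^sub>C (z *\<^sub>C b.defect z)) \<in> adjoint A"
      unfolding f0_def by (rule linear_op_scaleC[OF lin dA])
    then have f0A: "(f0, z *\<^sub>C f0) \<in> adjoint A"
      by (simp add: f0_def scaleC_scaleC mult.commute)
    have pf0: "p f0 = 1"
      using b.p_scaleC[of "b.defect z" "1 / p g"] dA b.p_defect[OF z0] b.pg_nonzero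
      by (simp add: f0_def H_def[symmetric] HI)
    have "(THE f. f \<in> H_plus A \<and> (\<lambda>h. rigged_Re A B f h - z * embed A f h) = K 1) = f0"
    proof (rule the_equality)
      have "R f0 h - z * embed A f0 h = K 1 h" for h
      proof (cases "h \<in> H")
        case True
        then show ?thesis using Rp[OF f0A True] pf0
          by (simp add: embed_def K1 cinner_scaleC_left flip: H_def)
      next
        case False
        then show ?thesis using R_out[OF HI[OF f0A] False] l_out[OF False]
          by (simp add: embed_def K1 flip: H_def)
      qed
      then show "f0 \<in> H_plus A \<and> (\<lambda>h. rigged_Re A B f0 h - z * embed A f0 h) = K 1"
        using HI[OF f0A] by (simp add: R_def H_def fun_eq_iff)
    next
      fix f assume f: "f \<in> H_plus A \<and> (\<lambda>h. rigged_Re A B f h - z * embed A f h) = K 1"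
      then have fH: "f \<in> H" and eq: "\<And>h. R f h - z * embed A f h = cnj (l h)"
        by (simp_all add: H_def R_def fun_eq_iff K1)
      have eqH: "R f h = z * cinner f h + cnj (l h)" if "h \<in> H" for h
        using eq[of h] that by (simp add: embed_def H_def[symmetric] algebra_simps)
      \<comment> \<open>Tested against Dom A, where l vanishes, the equation loses its right-hand
        side and says that f lies in ker (\<open>adjoint A\<close> - z). Together with p f = 1 this
        makes f - f0 an eigenvector of S or zero.\<close>
      have fA: "(f, z *\<^sub>C f) \<in> adjoint A"
      proof -
        have "cinner a' f = cinner a (z *\<^sub>C f)" if a: "(a, a') \<in> A" for a a'
        proof -
          have "a \<in> H" using a A_sub HI by blast
          then have "cinner f a' = z * cinner f a"
            using R_A[OF a fH] eqH[of a] l_A[OF a] by simp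
          then have "cinner f a' = cinner (z *\<^sub>C f) a" by (simp add: cinner_scaleC_left)
          then show ?thesis by (metis cinner_commute)
        qed
        then show ?thesis by (simp add: adjoint_on_def)
      qed
      have "p f = 1"
        using Rp[OF fA tH] eqH[OF tH] lt by (simp add: cinner_scaleC_left)
      have dif: "(f - f0, z *\<^sub>C (f - f0)) \<in> adjoint A"
        using linear_op_diff[OF lin fA f0A] by (simp add: complex_vector.scale_right_diff_distrib)
      have "p (f - f0) + p f0 = p f"
        using b.p_add[of "f - f0" f0] HI[OF dif] HI[OF f0A] by (simp flip: H_def)
      then have "f - f0 \<in> Domain S"
        unfolding b.p_kernel using \<open>p f = 1\<close> pf0 HI[OF dif] by (simp flip: H_def)
      then obtain k where "(f - f0, k) \<in> S" by blast
      moreover from this have "k = z *\<^sub>C (f - f0)"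
        using S_adj linear_op_unique[OF lin _ dif] by blast
      ultimately have "f - f0 = 0" using S.eigenvector_eq_zero z0 by blast
      then show "f = f0" by simp
    qed
    then have "impedance A B K z = l f0" by (simp add: impedance_def l_def)
    also have "\<dots> = b.weyl z"
      using l_scale[OF HI[OF dA], of "1 / p g"] by (simp add: f0_def b.weyl_def)
    finally show ?thesis .
  qed
  show thesis
  proof (rule that)
    show "boundary_pair (quasi_kernel A (rigged_Re A B)) A (channel_adjoint K) p g"
      using bp by (simp add: S_def l_def)
    show "p f = - \<i> * channel_adjoint K f" if "f \<in> Domain T" for f
      using pT[OF that] by (simp add: l_def)
    show "impedance A B K z = boundary_pair.weyl (quasi_kernel A (rigged_Re A B)) (channel_adjoint K) p g z"
      if "Im z > 0" for z
      using imp[OF that] by (simp add: S_def l_def)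
  qed
qed

section \<open>The Donoghue class and the value at i\<close>

lemma Donoghue_inv_at_i:
  assumes "Donoghue_inv \<kappa> M" "0 \<le> \<kappa>" "\<kappa> < 1"
  shows "M \<i> = \<i> * of_real ((1 + \<kappa>) / (1 - \<kappa>))"
proof -
  obtain \<mu> :: "real measure" where \<mu>: "sets \<mu> = sets borel"
    and mass: "(\<integral>\<^sup>+ x. ennreal (1 / (1 + x\<^sup>2)) \<partial>\<mu>) = ennreal ((1 + \<kappa>) / (1 - \<kappa>))"
    and M: "\<forall>z\<in>upper_half_plane. M z =
           (\<integral>x. 1 / (complex_of_real x - z) - complex_of_real (x / (1 + x\<^sup>2)) \<partial>\<mu>)"
    using assms(1) unfolding Donoghue_inv_def by blast
  have "M \<i> = (\<integral>x. 1 / (complex_of_real x - \<i>) - complex_of_real (x / (1 + x\<^sup>2)) \<partial>\<mu>)"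
    using M by (simp add: upper_half_plane_def)
  also have "\<dots> = (\<integral>x. \<i> * complex_of_real (1 / (1 + x\<^sup>2)) \<partial>\<mu>)"
  \<comment> \<open>Since 1 / (x - i) = (x + i) / (1 + x^2), the subtracted term cancels the real
    part of the kernel.\<close>
  proof (rule Bochner_Integration.integral_cong[OF refl])
    fix x :: real
    have "1 + x\<^sup>2 \<noteq> 0" using zero_le_power2[of x] by linarith
    then show "1 / (complex_of_real x - \<i>) - complex_of_real (x / (1 + x\<^sup>2)) = \<i> * complex_of_real (1 / (1 + x\<^sup>2))"
      by (simp add: complex_eq_iff Re_divide Im_divide add.commute power2_eq_square[of "1 + x\<^sup>2"])
  qed
  also have "\<dots> = \<i> * of_real (\<integral>x. 1 / (1 + x\<^sup>2) \<partial>\<mu>)"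
    by (simp only: integral_mult_right_zero integral_complex_of_real)
  also have "(\<integral>x. 1 / (1 + x\<^sup>2) \<partial>\<mu>) = (1 + \<kappa>) / (1 - \<kappa>)"
  proof -
    have "(\<lambda>x. 1 / (1 + x\<^sup>2)) \<in> borel_measurable \<mu>"
      unfolding measurable_cong_sets[OF \<mu> refl] by measurable
    then show ?thesis
      using assms(2,3) by (subst integral_eq_nn_integral) (auto simp: mass add_nonneg_nonneg)
  qed
  finally show ?thesis .
qed

context boundary_pair
begin

text \<open>The prescribed value at i fixes the mass in the Nevanlinna representation, and the two
  growth lemmas supply its remaining hypotheses. Agreement of V with the Weyl function on the upper
  half-plane suffices, as the class only sees values there.\<close>

lemma Donoghue_inv_weyl:
  assumes V: "\<And>z. Im z > 0 \<Longrightarrow> V z = weyl z"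
    and Vi: "weyl \<i> = \<i> * of_real ((1 + \<kappa>) / (1 - \<kappa>))" and \<kappa>: "0 \<le> \<kappa>" "\<kappa> < 1"
  shows "Donoghue_inv \<kappa> V"
proof -
  have m: "(1 + \<kappa>) / (1 - \<kappa>) > 0" using \<kappa> by simp
  obtain \<mu> :: "real measure" where \<mu>: "sets \<mu> = sets borel" "emeasure \<mu> UNIV = \<infinity>"
    "(\<integral>\<^sup>+ x. ennreal (1 / (1 + x\<^sup>2)) \<partial>\<mu>) = ennreal ((1 + \<kappa>) / (1 - \<kappa>))"
    "\<And>z. Im z > 0 \<Longrightarrow> weyl z =
       (\<integral>x. 1 / (complex_of_real x - z) - complex_of_real (x / (1 + x\<^sup>2)) \<partial>\<mu>)"
    using Nevanlinna_representation[OF weyl_holomorphic less_imp_le[OF Im_weyl_pos] Vi m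
        weyl_sublinear weyl_unbounded] by blast
  have "V holomorphic_on upper_half_plane"
    using weyl_holomorphic unfolding upper_half_plane_def
    by (rule holomorphic_transform) (simp add: V)
  moreover have "V ` upper_half_plane \<subseteq> upper_half_plane"
    by (auto simp: upper_half_plane_def V Im_weyl_pos)
  moreover have "\<forall>z\<in>upper_half_plane. V z =
       (\<integral>x. 1 / (complex_of_real x - z) - complex_of_real (x / (1 + x\<^sup>2)) \<partial>\<mu>)"
    using \<mu>(4) by (simp add: upper_half_plane_def V)
  ultimately show ?thesis unfolding Donoghue_inv_def using \<mu>(1-3) by blast
qed

text \<open>Both sides say \<open>p h = - p g\<close>: the right one by definition of \<open>p\<close>, the left one because the boundary
  condition of \<open>T\<close> reads \<open>p g - \<kappa> p h = - i (m p g - \<kappa> cnj m p h)\<close> with \<open>m = weyl i\<close>.\<close>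

lemma weyl_i_iff:
  assumes h: "h \<in> deficiency_space A (- \<i>)"
    and \<kappa>: "0 < \<kappa>" "\<kappa> < 1"
    and T: "p (g - of_real \<kappa> *\<^sub>C h) = - \<i> * l (g - of_real \<kappa> *\<^sub>C h)"
  shows "weyl \<i> = \<i> * of_real ((1 + \<kappa>) / (1 - \<kappa>)) \<longleftrightarrow> g + h \<in> Domain S"
proof -
  have gH: "g \<in> H_plus A" using g_adjoint by (auto simp: H_plus_def)
  have hH: "h \<in> H_plus A" using h by (auto simp: H_plus_def deficiency_space_def)
  have khA: "(- of_real \<kappa> *\<^sub>C h, - of_real \<kappa> *\<^sub>C (- \<i>) *\<^sub>C h) \<in> adjoint A"
    using h by (intro linear_op_scaleC[OF lin_adjoint]) (simp add: deficiency_space_def)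
  then have khH: "- of_real \<kappa> *\<^sub>C h \<in> H_plus A" by (auto simp: H_plus_def)
  have d: "g - of_real \<kappa> *\<^sub>C h = g + (- of_real \<kappa>) *\<^sub>C h"
    by (simp add: complex_vector.scale_minus_left)
  define m where "m = weyl \<i>"
  have lg: "l g = m * p g" using pg_nonzero by (simp add: m_def weyl_def defect_i)
  have lh: "l h = cnj m * p h" using l_eq_cnj_weyl[OF h] by (simp add: m_def)
  have T': "p g - \<kappa> * p h = - \<i> * (m * p g - \<kappa> * cnj m * p h)"
    using T unfolding d p_add[OF gH khH] l_add[OF gH khH] p_scaleC[OF hH] l_scaleC[OF hH] lg lh
    by (simp add: mult.assoc)
  have gh: "g + h \<in> Domain S \<longleftrightarrow> p g + p h = 0"
    using linear_op_add[OF lin_adjoint g_adjoint] h p_add[OF gH hH]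
    by (auto simp: p_kernel H_plus_def deficiency_space_def)
  define q where "q = (1 + \<kappa>) / (1 - \<kappa>)"
  have q: "q * (1 - \<kappa>) = 1 + \<kappa>" using \<kappa> by (simp add: q_def)
  show ?thesis
    unfolding gh m_def[symmetric] q_def[symmetric]
  proof
    assume mq: "m = \<i> * of_real q"
    have "p g - \<kappa> * p h = q * p g + \<kappa> * q * p h"
      using T' unfolding mq by (simp add: algebra_simps)
    \<comment> \<open>Multiplying by 1 - \<kappa> removes the fraction q and leaves 2 \<kappa> (p g
      + p h) = 0. Positivity of \<kappa> enters here: for \<kappa> = 0 the boundary condition of T
      does not involve h.\<close>
    then have "(1 - \<kappa>) * (p g - \<kappa> * p h) = (1 - \<kappa>) * (q * p g + \<kappa> * q * p h)" by simp
    also have "\<dots> = of_real (q * (1 - \<kappa>)) * (p g + \<kappa> * p h)" by (simp add: algebra_simps)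
    finally have "2 * \<kappa> * (p g + p h) = 0" unfolding q by (simp add: algebra_simps)
    then show "p g + p h = 0" using \<kappa> by simp
  next
    assume "p g + p h = 0"
    then have ph: "p h = - p g" by (simp add: add_eq_0_iff)
    have "(1 + \<kappa>) * p g = (- \<i> * (m + \<kappa> * cnj m)) * p g"
      using T' unfolding ph by (simp add: algebra_simps)
    then have "complex_of_real (1 + \<kappa>) = - \<i> * (m + \<kappa> * cnj m)"
      by (rule mult_right_cancel[OF pg_nonzero, THEN iffD1])
    \<comment> \<open>Conjugation flips only the imaginary part, so m + \<kappa>
      \<open>cnj m\<close> has real part (1 + \<kappa>) Re m and imaginary part (1 - \<kappa>) Im m.
      One complex equation thus determines m.\<close>
    then have im: "1 + \<kappa> = Im m * (1 - \<kappa>)" and re: "Re m * (1 + \<kappa>) = 0"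
      by (simp_all add: complex_eq_iff algebra_simps)
    from re have "Re m = 0" using \<kappa> by simp
    with im show "m = \<i> * of_real q" using \<kappa> by (simp add: complex_eq_iff q_def)
  qed
qed

end

theorem theorem5p4:
  fixes A T :: "'h::complex_hilbert graph"
    and B :: "'h rigged_op"
    and K :: "complex \<Rightarrow> 'h \<Rightarrow> complex"
    and \<kappa> :: real
  assumes "minimal_L_system A T B K"
    and "von_Neumann_parameter A T \<kappa>"
    and "0 < \<kappa>" and "\<kappa> < 1"
    and "\<not> impedance A B K constant_on upper_half_plane"
  shows "Donoghue_inv \<kappa> (impedance A B K) \<longleftrightarrow>
    Hypothesis_II A T (quasi_kernel A (rigged_Re A B)) \<kappa>"
proof -
  let ?V = "impedance A B K" and ?S = "quasi_kernel A (rigged_Re A B)"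
  have L: "L_system A T B K" using assms(1) by (simp add: minimal_L_system_def)
  \<comment> \<open>The equivalence is proved for every normalized pair satisfying the boundary
    condition of T. The pair from the von Neumann parameter then serves one direction and the pair
    from Hypothesis II the other, so the phases of the two pairs need not be compared.\<close>
  have key: "Donoghue_inv \<kappa> ?V \<longleftrightarrow> gp + gm \<in> Domain ?S"
    if gp: "gp \<in> deficiency_space A \<i>" "norm gp = 1" and gm: "gm \<in> deficiency_space A (- \<i>)" "norm gm = 1"
      and t: "gp - complex_of_real \<kappa> *\<^sub>C gm \<in> Domain T" for gp gm
  proof -
    let ?t = "gp - complex_of_real \<kappa> *\<^sub>C gm"
    obtain t' where t': "(?t, t') \<in> T" using t by blast
    have TA: "T \<subseteq> adjoint A" and lin: "linear_op (adjoint A)"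
      using L adjoint_linear_op
      by (auto simp: L_system_def class_Lambda_def closed_densely_defined_symmetric_def)
    have "(?t, \<i> *\<^sub>C gp - complex_of_real \<kappa> *\<^sub>C (- \<i>) *\<^sub>C gm) \<in> adjoint A"
      using gp gm by (intro linear_op_diff linear_op_scaleC lin) (simp_all add: deficiency_space_def)
    \<comment> \<open>T is contained in \<open>adjoint A\<close>, which is single-valued and acts on
      gp and gm as i and -i.\<close>
    then have "t' = \<i> *\<^sub>C gp - complex_of_real \<kappa> *\<^sub>C (- \<i>) *\<^sub>C gm"
      using TA t' linear_op_unique[OF lin] by blast
    also have "\<dots> = \<i> *\<^sub>C gp + (\<i> * complex_of_real \<kappa>) *\<^sub>C gm"
      by (simp add: scaleC_scaleC complex_vector.scale_minus_left mult.commute)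
    finally have "Im (cinner t' ?t) = 1 - \<kappa>\<^sup>2"
      using Im_cinner_main_vector gp gm by simp
    moreover have "\<kappa>\<^sup>2 < 1" using assms(3,4) by (simp add: power_less_one_iff)
    ultimately have nonreal: "Im (cinner t' ?t) \<noteq> 0" by simp
    obtain p where bp: "boundary_pair ?S A (channel_adjoint K) p gp"
      and pT: "\<And>f. f \<in> Domain T \<Longrightarrow> p f = - \<i> * channel_adjoint K f"
      and V: "\<And>z. Im z > 0 \<Longrightarrow> ?V z = boundary_pair.weyl ?S (channel_adjoint K) p gp z"
      using L_system_boundary_pair[OF L t' nonreal gp] by blast
    interpret boundary_pair ?S A "channel_adjoint K" p gp by (rule bp)
    have "Donoghue_inv \<kappa> ?V \<longleftrightarrow> weyl \<i> = \<i> * of_real ((1 + \<kappa>) / (1 - \<kappa>))"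
    proof
      assume "Donoghue_inv \<kappa> ?V"
      then show "weyl \<i> = \<i> * of_real ((1 + \<kappa>) / (1 - \<kappa>))"
        using Donoghue_inv_at_i V[of \<i>] assms(3,4) by simp
    next
      assume "weyl \<i> = \<i> * of_real ((1 + \<kappa>) / (1 - \<kappa>))"
      then show "Donoghue_inv \<kappa> ?V"
        using Donoghue_inv_weyl[OF V] assms(3,4) by simp
    qed
    also have "\<dots> \<longleftrightarrow> gp + gm \<in> Domain ?S"
      by (rule weyl_i_iff[OF gm(1) assms(3,4) pT[OF t]])
    finally show ?thesis .
  qed
  show ?thesis
    using assms(2) key unfolding Hypothesis_II_def von_Neumann_parameter_def by blast
qed

end
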